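(* Let $Av(B)$ be a wreath-closed permutation class (i.e. $B$ consists only of simple permutations). Then $Av(B)$ contains arbitrarily long proper pin-permutations if and only if there exist words of arbitrary length on the alphabet $\{L,R,U,D\}$ having no factor in the set $\bigcup_{\pi\in B}E(\pi)\cup\{LL,LR,RR,RL,UU,UD,DD,DU\}$.
   Context: Permutations of length $n$ are bijections of $\{1,\dots,n\}$, identified with their diagrams $\{(i,\sigma(i))\}$. $\pi\le\sigma$ means some subsequence of $\sigma$ is order isomorphic to $\pi$; $Av(B)$ is the set of permutations containing no element of $B$. A permutation of length $n$ is simple if no set of $l$ consecutive positions ($2\le l\le n-1$) has values forming a set of consecutive integers. Pins are points of $\mathbb{Z}^2$. A pin $p$ separates a set $P$ from a set $Q$ horizontally (resp. vertically) if the horizontal (resp. vertical) line through $p$ has $P$ strictly on one side and $Q$ strictly on the other. A pin sequence is a sequence $(p_1,\dots,p_k)$ of pins, no two in a common row or column, such that for every $i\ge2$, $p_i$ lies outside the bounding box of $\{p_1,\dots,p_{i-1}\}$ and either $p_i$ separates $p_{i-1}$ from $\{p_1,\dots,p_{i-2}\}$, or $p_i$ is independent from $\{p_1,\dots,p_{i-1}\}$ (does not separate it into two nonempty sets). A pin representation of $\sigma$ is a pin sequence order isomorphic to the diagram of $\sigma$. It is proper if every $p_i$ with $i\ge3$ separates $p_{i-1}$ from $\{p_1,\dots,p_{i-2}\}$. A proper pin-permutation is a permutation admitting a proper pin representation. Pin words are words on $\{1,2,3,4,U,D,L,R\}$ obtained as follows: given a pin representation $(p_1,\dots,p_n)$,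 choose an origin $p_0$ such that $(p_0,\dots,p_n)$ is a pin sequence, and encode each $p_i$, $i\ge1$: $U$ (resp. $D,L,R$) if $p_i$ separates $p_{i-1}$ from $\{p_0,\dots,p_{i-2}\}$ and lies above (resp. below, left of, right of) the bounding box of $\{p_0,\dots,p_{i-1}\}$; $1$ (resp. $2,3,4$) if $p_i$ is independent from $\{p_0,\dots,p_{i-1}\}$ and lies in the up-right (resp. up-left, bottom-left, bottom-right) corner region of that bounding box. Such a word corresponds to the permutation $\sigma$. Letters $1,2,3,4$ are numerals, $U,D,L,R$ directions. A strict pin word has length $\ge2$, a numeral first, then only directions; a quasi-strict pin word has length $\ge2$, two numerals first, then only directions. Let $\mathcal{SP}$ be the set of words consisting of a numeral followed by a nonempty word over $\{L,R,U,D\}$ alternating between letters of $\{L,R\}$ and $\{U,D\}$; let $M$ be the set of words of length $\ge3$ over $\{L,R,U,D\}$ alternating between $\{L,R\}$ and $\{U,D\}$. Define $\phi:\mathcal{SP}\to M$ by $\phi(u'u'')=\varphi(u')u''$ for $|u'|=2$ with $\varphi$: $1R\mapsto RUR$, $2R\mapsto LUR$, $3R\mapsto LDR$, $4R\mapsto RDR$, $1L\mapsto RUL$, $2L\mapsto LUL$, $3L\mapsto LDL$, $4L\mapsto RDL$, $1U\mapsto URU$, $2U\mapsto ULU$, $3U\mapsto DLU$, $4U\mapsto DRU$, $1D\mapsto URD$, $2D\mapsto ULD$, $3D\mapsto DLD$, $4D\mapsto DRD$; for single numerals $\phi(1)=\{UR,RU\}$, $\phi(2)=\{UL,LU\}$,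 $\phi(3)=\{DL,LD\}$, $\phi(4)=\{RD,DR\}$. For a simple permutation $\pi$, $E(\pi)$ is the set of words $\phi(u)$ for $u$ a strict pin word corresponding to $\pi$, together with the words $v\in M$ of the form $x\,\phi(u_2\cdots u_{|u|})$ with $u$ a quasi-strict pin word corresponding to $\pi$ and $x\in\{LU,LD,RU,RD,UL,UR,DL,DR\}$. A factor is a contiguous subword.
   Formalization: The permutations in B are additionally required to have length at least 2; for B={1} the claim fails, since Av(B) has no nonempty permutation while E(1) is empty and arbitrarily long alternating words exist. *)

theory Defs
  imports Main "HOL-Library.Sublist"
begin

definition is_perm :: "nat list \<Rightarrow> bool" where
  "is_perm \<sigma> \<longleftrightarrow> set \<sigma> = {1..length \<sigma>}"

definition order_iso_list :: "nat list \<Rightarrow> nat list \<Rightarrow> bool" where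
  "order_iso_list xs ys \<longleftrightarrow> length xs = length ys \<and>
     (\<forall>i<length xs. \<forall>j<length xs. (xs ! i < xs ! j) = (ys ! i < ys ! j))"

definition contains :: "nat list \<Rightarrow> nat list \<Rightarrow> bool" where
  "contains \<pi> \<sigma> \<longleftrightarrow> (\<exists>\<tau>. subseq \<tau> \<sigma> \<and> order_iso_list \<pi> \<tau>)"

definition Av :: "nat list set \<Rightarrow> nat list set" where
  "Av B = {\<sigma>. is_perm \<sigma> \<and> (\<forall>\<pi>\<in>B. \<not> contains \<pi> \<sigma>)}"

definition simple_perm :: "nat list \<Rightarrow> bool" where
  "simple_perm \<sigma> \<longleftrightarrow> is_perm \<sigma> \<and>
     \<not> (\<exists>i l m. 2 \<le> l \<and> l \<le> length \<sigma> - 1 \<and> i + l \<le> length \<sigma> \<and>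
            set (take l (drop i \<sigma>)) = {m..<m + l})"

type_synonym pin = "int \<times> int"

text \<open>horizontal line through p: y = snd p; vertical line: x = fst p\<close>
definition sep_h :: "pin \<Rightarrow> pin set \<Rightarrow> pin set \<Rightarrow> bool" where
  "sep_h p P Q \<longleftrightarrow>
     ((\<forall>q\<in>P. snd q < snd p) \<and> (\<forall>q\<in>Q. snd p < snd q)) \<or>
     ((\<forall>q\<in>P. snd p < snd q) \<and> (\<forall>q\<in>Q. snd q < snd p))"

definition sep_v :: "pin \<Rightarrow> pin set \<Rightarrow> pin set \<Rightarrow> bool" where
  "sep_v p P Q \<longleftrightarrow>
     ((\<forall>q\<in>P. fst q < fst p) \<and> (\<forall>q\<in>Q. fst p < fst q)) \<or>
     ((\<forall>q\<in>P. fst p < fst q) \<and> (\<forall>q\<in>Q. fst q < fst p))"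

definition separates :: "pin \<Rightarrow> pin set \<Rightarrow> pin set \<Rightarrow> bool" where
  "separates p P Q \<longleftrightarrow> sep_h p P Q \<or> sep_v p P Q"

definition independent :: "pin \<Rightarrow> pin set \<Rightarrow> bool" where
  "independent p S \<longleftrightarrow>
     \<not> (\<exists>P Q. P \<noteq> {} \<and> Q \<noteq> {} \<and> P \<union> Q = S \<and> separates p P Q)"

definition in_bbox :: "pin \<Rightarrow> pin set \<Rightarrow> bool" where
  "in_bbox p S \<longleftrightarrow>
     Min (fst ` S) \<le> fst p \<and> fst p \<le> Max (fst ` S) \<and>
     Min (snd ` S) \<le> snd p \<and> snd p \<le> Max (snd ` S)"

definition pin_seq :: "pin list \<Rightarrow> bool" where
  "pin_seq ps \<longleftrightarrow>
     (\<forall>i<length ps. \<forall>j<length ps. i \<noteq> j \<longrightarrow>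
          fst (ps ! i) \<noteq> fst (ps ! j) \<and> snd (ps ! i) \<noteq> snd (ps ! j)) \<and>
     (\<forall>i. 1 \<le> i \<and> i < length ps \<longrightarrow>
          \<not> in_bbox (ps ! i) (set (take i ps)) \<and>
          (separates (ps ! i) {ps ! (i - 1)} (set (take (i - 1) ps)) \<or>
           independent (ps ! i) (set (take i ps))))"

definition diagram :: "nat list \<Rightarrow> pin set" where
  "diagram \<sigma> = {(int (i + 1), int (\<sigma> ! i)) | i. i < length \<sigma>}"

definition order_iso_pts :: "pin set \<Rightarrow> pin set \<Rightarrow> bool" where
  "order_iso_pts S T \<longleftrightarrow> (\<exists>f. bij_betw f S T \<and>
     (\<forall>p\<in>S. \<forall>q\<in>S. (fst p < fst q \<longleftrightarrow> fst (f p) < fst (f q)) \<and>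
                   (snd p < snd q \<longleftrightarrow> snd (f p) < snd (f q))))"

definition pin_rep :: "pin list \<Rightarrow> nat list \<Rightarrow> bool" where
  "pin_rep ps \<sigma> \<longleftrightarrow> pin_seq ps \<and> order_iso_pts (set ps) (diagram \<sigma>)"

definition proper_pin_seq :: "pin list \<Rightarrow> bool" where
  "proper_pin_seq ps \<longleftrightarrow> pin_seq ps \<and>
     (\<forall>i. 2 \<le> i \<and> i < length ps \<longrightarrow>
        separates (ps ! i) {ps ! (i - 1)} (set (take (i - 1) ps)))"

definition proper_pin_perm :: "nat list \<Rightarrow> bool" where
  "proper_pin_perm \<sigma> \<longleftrightarrow> is_perm \<sigma> \<and> (\<exists>ps. pin_rep ps \<sigma> \<and> proper_pin_seq ps)"

datatype letter = N1 | N2 | N3 | N4 | U | D | L | R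

definition numerals :: "letter set" where "numerals = {N1, N2, N3, N4}"
definition directions :: "letter set" where "directions = {L, R, U, D}"

definition above :: "pin \<Rightarrow> pin set \<Rightarrow> bool" where
  "above p S \<longleftrightarrow> Max (snd ` S) < snd p \<and> Min (fst ` S) \<le> fst p \<and> fst p \<le> Max (fst ` S)"
definition below :: "pin \<Rightarrow> pin set \<Rightarrow> bool" where
  "below p S \<longleftrightarrow> snd p < Min (snd ` S) \<and> Min (fst ` S) \<le> fst p \<and> fst p \<le> Max (fst ` S)"
definition left_of :: "pin \<Rightarrow> pin set \<Rightarrow> bool" where
  "left_of p S \<longleftrightarrow> fst p < Min (fst ` S) \<and> Min (snd ` S) \<le> snd p \<and> snd p \<le> Max (snd ` S)"
definition right_of :: "pin \<Rightarrow> pin set \<Rightarrow> bool" where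
  "right_of p S \<longleftrightarrow> Max (fst ` S) < fst p \<and> Min (snd ` S) \<le> snd p \<and> snd p \<le> Max (snd ` S)"

definition corner :: "letter \<Rightarrow> pin \<Rightarrow> pin set \<Rightarrow> bool" where
  "corner a p S \<longleftrightarrow> (case a of
      N1 \<Rightarrow> Max (fst ` S) < fst p \<and> Max (snd ` S) < snd p
    | N2 \<Rightarrow> fst p < Min (fst ` S) \<and> Max (snd ` S) < snd p
    | N3 \<Rightarrow> fst p < Min (fst ` S) \<and> snd p < Min (snd ` S)
    | N4 \<Rightarrow> Max (fst ` S) < fst p \<and> snd p < Min (snd ` S)
    | _ \<Rightarrow> False)"

text \<open>encodes P q a: P = [p_0,...,p_(i-1)] (nonempty), q = p_i, a its letter\<close>
definition encodes :: "pin list \<Rightarrow> pin \<Rightarrow> letter \<Rightarrow> bool" where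
  "encodes P q a \<longleftrightarrow> (case a of
      U \<Rightarrow> separates q {last P} (set (butlast P)) \<and> above q (set P)
    | D \<Rightarrow> separates q {last P} (set (butlast P)) \<and> below q (set P)
    | L \<Rightarrow> separates q {last P} (set (butlast P)) \<and> left_of q (set P)
    | R \<Rightarrow> separates q {last P} (set (butlast P)) \<and> right_of q (set P)
    | _ \<Rightarrow> independent q (set P) \<and> corner a q (set P))"

definition pin_word_of :: "letter list \<Rightarrow> nat list \<Rightarrow> bool" where
  "pin_word_of w \<sigma> \<longleftrightarrow> (\<exists>ps p0. pin_rep ps \<sigma> \<and> pin_seq (p0 # ps) \<and>
      length w = length ps \<and>
      (\<forall>i<length ps. encodes (take (i + 1) (p0 # ps)) (ps ! i) (w ! i)))"

definition strict_pw :: "letter list \<Rightarrow> bool" where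
  "strict_pw w \<longleftrightarrow> 2 \<le> length w \<and> hd w \<in> numerals \<and> set (tl w) \<subseteq> directions"

definition quasi_strict_pw :: "letter list \<Rightarrow> bool" where
  "quasi_strict_pw w \<longleftrightarrow> 2 \<le> length w \<and> w ! 0 \<in> numerals \<and> w ! 1 \<in> numerals \<and>
     set (drop 2 w) \<subseteq> directions"

definition horiz :: "letter \<Rightarrow> bool" where "horiz a \<longleftrightarrow> a = L \<or> a = R"
definition vert :: "letter \<Rightarrow> bool" where "vert a \<longleftrightarrow> a = U \<or> a = D"

definition alternating :: "letter list \<Rightarrow> bool" where
  "alternating w \<longleftrightarrow> set w \<subseteq> directions \<and>
     (\<forall>i. i + 1 < length w \<longrightarrow> (horiz (w ! i) \<longleftrightarrow> vert (w ! (i + 1))))"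

definition SP :: "letter list set" where
  "SP = {w. length w \<ge> 2 \<and> hd w \<in> numerals \<and> alternating (tl w)}"

definition M :: "letter list set" where
  "M = {w. length w \<ge> 3 \<and> alternating w}"

fun vphi :: "letter \<Rightarrow> letter \<Rightarrow> letter list" where
  "vphi N1 R = [R,U,R]" | "vphi N2 R = [L,U,R]" | "vphi N3 R = [L,D,R]" | "vphi N4 R = [R,D,R]"
| "vphi N1 L = [R,U,L]" | "vphi N2 L = [L,U,L]" | "vphi N3 L = [L,D,L]" | "vphi N4 L = [R,D,L]"
| "vphi N1 U = [U,R,U]" | "vphi N2 U = [U,L,U]" | "vphi N3 U = [D,L,U]" | "vphi N4 U = [D,R,U]"
| "vphi N1 D = [U,R,D]" | "vphi N2 D = [U,L,D]" | "vphi N3 D = [D,L,D]" | "vphi N4 D = [D,R,D]"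
| "vphi _ _ = []"

fun phi :: "letter list \<Rightarrow> letter list set" where
  "phi [N1] = {[U,R],[R,U]}"
| "phi [N2] = {[U,L],[L,U]}"
| "phi [N3] = {[D,L],[L,D]}"
| "phi [N4] = {[R,D],[D,R]}"
| "phi (a # b # rest) = {vphi a b @ rest}"
| "phi _ = {}"

definition Xpre :: "letter list set" where
  "Xpre = {[L,U],[L,D],[R,U],[R,D],[U,L],[U,R],[D,L],[D,R]}"

definition E :: "nat list \<Rightarrow> letter list set" where
  "E \<pi> =
     {v. \<exists>u. strict_pw u \<and> u \<in> SP \<and> pin_word_of u \<pi> \<and> v \<in> phi u} \<union>
     {v. v \<in> M \<and> (\<exists>u x y. quasi_strict_pw u \<and> pin_word_of u \<pi> \<and>
            (tl u \<in> SP \<or> (tl u \<in> {[N1],[N2],[N3],[N4]})) \<and>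
            x \<in> Xpre \<and> y \<in> phi (tl u) \<and> v = x @ y)}"

definition factor :: "'a list \<Rightarrow> 'a list \<Rightarrow> bool" where
  "factor v w \<longleftrightarrow> (\<exists>a b. w = a @ v @ b)"

end

theory Submission
  imports Defs
begin

text \<open>
  Drop the first pins of a proper pin sequence: every remaining pin has a direction, consecutive
  directions alternate, and the word of directions determines the order type. Two consecutive
  directions also tell in which quadrant a pin lies relative to all pins at least two steps
  older, so a factor of the word describes the order type of a run of pins, possibly preceded by
  one much older pin; these are exactly the words in \<open>E \<pi>\<close>. Conversely, if a pin is skipped in a
  pattern, the pins chosen before it form an interval of the pattern, because all later pins
  treat them alike. Hence a simple pattern consists of a run of consecutive pins, or of a single
  pin followed by such a run, and its word is a factor in \<open>E \<pi>\<close>. Explicit coordinates on a spiral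
  realise any alternating word.
\<close>

section \<open>Placement of a single pin\<close>

text \<open>Pin words measure every pin against an origin that is not a point of the permutation,
  and \<open>E\<close> collects words of two shapes. Both obstacles are met by a placement relation
  that uses coordinate comparisons only: in \<open>pin_in_dir d S l q\<close> the direction
  \<open>d\<close> fixes the axis along which \<open>q\<close> cuts off its predecessor
  \<open>l\<close> from the older pins \<open>S\<close>. Without \<open>Min\<close>,
  \<open>Max\<close> and independence it survives any shrinking of \<open>S\<close>. Hence older
  pins may be dropped, and a run of a chain is again a chain whose pin 0 is either the origin
  (strict words) or the first point of the pattern (quasi-strict words).

  A numeral is spelled by two directions because pin \<open>i\<close> runs between pin
  \<open>i - 1\<close> and all older pins on the axis of letter \<open>i - 1\<close>, and beyond all
  of them on the axis of letter \<open>i\<close>. This reads the letters of both pins, while pins 0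
  and 1 have none; therefore patterns are sought only from pin 3 on. The prefix \<open>x\<close> in
  the quasi-strict part of \<open>E\<close> leaves room for an older pin whose own direction does
  not influence the order type.\<close>

definition pin_in_dir :: "letter \<Rightarrow> pin set \<Rightarrow> pin \<Rightarrow> pin \<Rightarrow> bool" where
  "pin_in_dir d S l q \<longleftrightarrow> (case d of
      U \<Rightarrow> (\<forall>p\<in>insert l S. snd p < snd q) \<and> sep_v q {l} S
    | D \<Rightarrow> (\<forall>p\<in>insert l S. snd q < snd p) \<and> sep_v q {l} S
    | R \<Rightarrow> (\<forall>p\<in>insert l S. fst p < fst q) \<and> sep_h q {l} S
    | L \<Rightarrow> (\<forall>p\<in>insert l S. fst q < fst p) \<and> sep_h q {l} S
    | _ \<Rightarrow> False)"

text \<open>This is \<open>corner\<close> freed of the bounding box: the two agree for finite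
  nonempty \<open>S\<close>, independence follows from the position alone, and passing to subsets is
  immediate.\<close>

definition in_quadrant :: "letter \<Rightarrow> pin set \<Rightarrow> pin \<Rightarrow> bool" where
  "in_quadrant a S q \<longleftrightarrow> (case a of
      N1 \<Rightarrow> \<forall>p\<in>S. fst p < fst q \<and> snd p < snd q
    | N2 \<Rightarrow> \<forall>p\<in>S. fst q < fst p \<and> snd p < snd q
    | N3 \<Rightarrow> \<forall>p\<in>S. fst q < fst p \<and> snd q < snd p
    | N4 \<Rightarrow> \<forall>p\<in>S. fst p < fst q \<and> snd q < snd p
    | _ \<Rightarrow> False)"

text \<open>Read off from \<open>phi\<close> on single numerals, so that the encoding in
  \<open>E\<close> and the geometry share one relation: \<open>b\<close> and \<open>c\<close>, in
  either order, are the directions that bound quadrant \<open>a\<close>.\<close>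

definition quadrant_of :: "letter \<Rightarrow> letter \<Rightarrow> letter \<Rightarrow> bool" where
  "quadrant_of a b c \<longleftrightarrow> [b, c] \<in> phi [a]"

lemma quadrant_of_cases:
  "quadrant_of a b c \<longleftrightarrow>
     (a, b, c) \<in> {(N1,U,R),(N1,R,U),(N2,U,L),(N2,L,U),(N3,D,L),(N3,L,D),(N4,R,D),(N4,D,R)}"
  by (cases a) (auto simp: quadrant_of_def)

text \<open>This makes dropping pins harmless: direction and separation persist as long as the
  predecessor \<open>l\<close> stays.\<close>

lemma pin_in_dir_mono: "pin_in_dir d S l q \<Longrightarrow> S' \<subseteq> S \<Longrightarrow> pin_in_dir d S' l q"
  unfolding pin_in_dir_def sep_h_def sep_v_def by (cases d; simp; blast)

lemma in_quadrant_mono: "in_quadrant a S q \<Longrightarrow> S' \<subseteq> S \<Longrightarrow> in_quadrant a S' q"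
  unfolding in_quadrant_def by (cases a; simp; blast)

lemma in_quadrant_imp_numeral: "in_quadrant a S q \<Longrightarrow> a \<in> numerals"
  by (cases a) (auto simp: in_quadrant_def numerals_def)

lemma pin_in_dir_imp_direction: "pin_in_dir d S l q \<Longrightarrow> d \<in> directions"
  by (cases d) (auto simp: pin_in_dir_def directions_def)

lemma ex_in_quadrant:
  assumes "fst p \<noteq> fst q" "snd p \<noteq> snd q"
  shows "\<exists>a. in_quadrant a {p} q"
proof -
  have "in_quadrant N1 {p} q \<or> in_quadrant N2 {p} q \<or> in_quadrant N3 {p} q \<or> in_quadrant N4 {p} q"
    using assms by (auto simp: in_quadrant_def)
  then show ?thesis by blast
qed

lemma in_quadrant_coords_neq:
  "in_quadrant a S q \<Longrightarrow> p \<in> S \<Longrightarrow> fst p \<noteq> fst q \<and> snd p \<noteq> snd q"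
  unfolding in_quadrant_def by (cases a; simp; metis less_irrefl)

lemma pin_in_dir_coords_neq:
  "pin_in_dir d S l q \<Longrightarrow> p \<in> insert l S \<Longrightarrow> fst p \<noteq> fst q \<and> snd p \<noteq> snd q"
  unfolding pin_in_dir_def sep_h_def sep_v_def by (cases d; simp; metis less_irrefl)

lemma bbox_sides:
  fixes S :: "pin set"
  assumes "finite S" "S \<noteq> {}"
  shows "Max (fst ` S) < x \<longleftrightarrow> (\<forall>p\<in>S. fst p < x)" "x < Min (fst ` S) \<longleftrightarrow> (\<forall>p\<in>S. x < fst p)"
    "Max (snd ` S) < x \<longleftrightarrow> (\<forall>p\<in>S. snd p < x)" "x < Min (snd ` S) \<longleftrightarrow> (\<forall>p\<in>S. x < snd p)"
  using assms by simp_all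

lemma in_bbox_iff:
  assumes "finite S" "S \<noteq> {}"
  shows "in_bbox q S \<longleftrightarrow> \<not> ((\<forall>p\<in>S. fst p < fst q) \<or> (\<forall>p\<in>S. fst q < fst p) \<or>
    (\<forall>p\<in>S. snd p < snd q) \<or> (\<forall>p\<in>S. snd q < snd p))"
  unfolding bbox_sides[OF assms, symmetric] in_bbox_def by linarith

lemma in_quadrant_outside_bbox:
  assumes "finite S" "S \<noteq> {}" "in_quadrant a S q"
  shows "\<not> in_bbox q S"
  using assms(3) unfolding in_bbox_iff[OF assms(1,2)] in_quadrant_def by (cases a) auto

lemma pin_in_dir_outside_bbox:
  assumes "finite S" "pin_in_dir d S l q"
  shows "\<not> in_bbox q (insert l S)"
proof -
  have "finite (insert l S)" "insert l S \<noteq> {}" using assms(1) by auto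
  from in_bbox_iff[OF this] show ?thesis
    using assms(2) unfolding pin_in_dir_def by (cases d) auto
qed

lemma pin_in_dir_separates: "pin_in_dir d S l q \<Longrightarrow> separates q {l} S"
  unfolding pin_in_dir_def separates_def by (cases d) auto

text \<open>A separating line through \<open>q\<close> has points of \<open>S\<close> on both sides,
  whereas a quadrant keeps all of \<open>S\<close> on one side of each line through
  \<open>q\<close>.\<close>

lemma in_quadrant_independent:
  assumes "in_quadrant a S q" shows "independent q S"
  unfolding independent_def separates_def sep_h_def sep_v_def
proof (rule notI, elim exE conjE)
  fix P Q assume "P \<noteq> {}" "Q \<noteq> {}" "P \<union> Q = S"
    and sep: "((\<forall>x\<in>P. snd x < snd q) \<and> (\<forall>x\<in>Q. snd q < snd x) \<or> (\<forall>x\<in>P. snd q < snd x) \<and>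
        (\<forall>x\<in>Q. snd x < snd q)) \<or>
      (\<forall>x\<in>P. fst x < fst q) \<and> (\<forall>x\<in>Q. fst q < fst x) \<or> (\<forall>x\<in>P. fst q < fst x) \<and> (\<forall>x\<in>Q. fst x < fst q)"
  then obtain x y where xy: "x \<in> P" "y \<in> Q" "x \<in> S" "y \<in> S" by blast
  have "(fst x < fst q \<longleftrightarrow> fst y < fst q) \<and> (snd x < snd q \<longleftrightarrow> snd y < snd q)"
    using assms xy(3,4) unfolding in_quadrant_def by (cases a; simp; meson order.asym)
  moreover have "(snd x < snd q \<and> snd q < snd y) \<or> (snd q < snd x \<and> snd y < snd q) \<or>
      (fst x < fst q \<and> fst q < fst y) \<or> (fst q < fst x \<and> fst y < fst q)"
    using sep xy(1,2) by blast
  ultimately show False by auto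
qed

lemma corner_iff_in_quadrant:
  assumes "finite S" "S \<noteq> {}"
  shows "corner a q S \<longleftrightarrow> in_quadrant a S q"
  using assms by (cases a) (auto simp: corner_def in_quadrant_def)

lemma encodes_numeral_iff:
  assumes "P \<noteq> []" "a \<in> numerals"
  shows "encodes P q a \<longleftrightarrow> in_quadrant a (set P) q"
proof -
  have "encodes P q a \<longleftrightarrow> independent q (set P) \<and> corner a q (set P)"
    using assms(2) by (auto simp: encodes_def numerals_def)
  then show ?thesis
    using in_quadrant_independent[of a "set P" q] corner_iff_in_quadrant[of "set P"] assms(1)
      by auto
qed

text \<open>The column of \<open>q\<close> lies between that of \<open>l\<close> and that of any
  point of \<open>S\<close>; a nonempty \<open>S\<close> supplies the second bound.\<close>

lemma sep_v_within_bbox: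
  assumes "finite S" "S \<noteq> {}" "sep_v q {l} S"
  shows "Min (fst ` insert l S) \<le> fst q \<and> fst q \<le> Max (fst ` insert l S)"
proof -
  obtain s where s: "s \<in> S" using assms(2) by blast
  have "Min (fst ` insert l S) \<le> fst x \<and> fst x \<le> Max (fst ` insert l S)" if "x \<in> insert l S" for x
    using assms(1) that by (intro conjI Min_le Max_ge imageI finite_imageI) auto
  from this[of l] this[of s] show ?thesis
    using assms(3) s unfolding sep_v_def by (auto dest!: bspec[OF _ s])
qed

lemma sep_h_within_bbox:
  assumes "finite S" "S \<noteq> {}" "sep_h q {l} S"
  shows "Min (snd ` insert l S) \<le> snd q \<and> snd q \<le> Max (snd ` insert l S)"
proof -
  obtain s where s: "s \<in> S" using assms(2) by blast
  have "Min (snd ` insert l S) \<le> snd x \<and> snd x \<le> Max (snd ` insert l S)" if "x \<in> insert l S" for x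
    using assms(1) that by (intro conjI Min_le Max_ge imageI finite_imageI) auto
  from this[of l] this[of s] show ?thesis
    using assms(3) s unfolding sep_h_def by (auto dest!: bspec[OF _ s])
qed

text \<open>\<open>encodes\<close> leaves the axis of separation open, but the position decides it.
  A horizontal line through a pin above or below everything has no points on its far side
  (\<open>nh\<close>), and a separating vertical line stays within the horizontal extent of the box
  (\<open>v\<close>). Both arguments use a pin older than the last one, hence
  \<open>butlast P \<noteq> []\<close>.\<close>

lemma encodes_direction_iff:
  assumes "butlast P \<noteq> []" "d \<in> directions"
  shows "encodes P q d \<longleftrightarrow> pin_in_dir d (set (butlast P)) (last P) q"
proof -
  let ?S = "set (butlast P)" and ?l = "last P"
  have P: "set P = insert ?l ?S" using assms(1)
    by (metis Un_insert_right append_butlast_last_id butlast.simps(1) list.set(1) list.set(2) set_append sup_bot.right_neutral)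
  obtain s where s: "s \<in> ?S" using assms(1) by (meson last_in_set)
  have v: "sep_v q {?l} ?S \<Longrightarrow> Min (fst ` insert ?l ?S) \<le> fst q \<and> fst q \<le> Max (fst ` insert ?l ?S)"
    using sep_v_within_bbox[of ?S q ?l] s by fastforce
  have h: "sep_h q {?l} ?S \<Longrightarrow> Min (snd ` insert ?l ?S) \<le> snd q \<and> snd q \<le> Max (snd ` insert ?l ?S)"
    using sep_h_within_bbox[of ?S q ?l] s by fastforce
  have nh: "\<not> (sep_h q {?l} ?S \<and> (\<forall>p\<in>insert ?l ?S. snd p < snd q))" "\<not> (sep_h q {?l} ?S \<and>
      (\<forall>p\<in>insert ?l ?S. snd q < snd p))"
    and nv: "\<not> (sep_v q {?l} ?S \<and> (\<forall>p\<in>insert ?l ?S. fst p < fst q))" "\<not> (sep_v q {?l} ?S \<and>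
        (\<forall>p\<in>insert ?l ?S. fst q < fst p))"
    using s unfolding sep_h_def sep_v_def by (auto intro!: bexI[OF _ s])
  have "finite (insert ?l ?S)" "insert ?l ?S \<noteq> {}" by auto
  note b = bbox_sides[OF this]
  consider "d = U" | "d = D" | "d = L" | "d = R" using assms(2) by (auto simp: directions_def)
  then show ?thesis
  proof cases
    case 1
    then show ?thesis unfolding encodes_def pin_in_dir_def above_def separates_def P b
      using v nh by (simp only: letter.case) blast
  next
    case 2
    then show ?thesis unfolding encodes_def pin_in_dir_def below_def separates_def P b
      using v nh by (simp only: letter.case) blast
  next
    case 3
    then show ?thesis unfolding encodes_def pin_in_dir_def left_of_def separates_def P b
      using h nv by (simp only: letter.case) blast
  next
    case 4
    then show ?thesis unfolding encodes_def pin_in_dir_def right_of_def separates_def P b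
      using h nv by (simp only: letter.case) blast
  qed
qed

text \<open>A separating vertical line keeps \<open>q\<close> within the horizontal extent of the
  box, so being outside the box forces \<open>U\<close> or \<open>D\<close>; a horizontal one forces
  \<open>R\<close> or \<open>L\<close> in the same way.\<close>

lemma ex_pin_in_dir:
  assumes "finite S" "S \<noteq> {}" "separates q {l} S" "\<not> in_bbox q (insert l S)"
  shows "\<exists>d. pin_in_dir d S l q"
proof -
  let ?T = "insert l S"
  have T: "finite ?T" "?T \<noteq> {}" using assms(1) by auto
  have out: "Max (fst ` ?T) < fst q \<or> fst q < Min (fst ` ?T) \<or> Max (snd ` ?T) < snd q \<or>
      snd q < Min (snd ` ?T)"
    using assms(4) unfolding in_bbox_def by linarith
  show ?thesis
  proof (cases "sep_v q {l} S")
    case True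
    then have "Max (snd ` ?T) < snd q \<or> snd q < Min (snd ` ?T)"
      using sep_v_within_bbox[OF assms(1,2) True] out by linarith
    then have "pin_in_dir U S l q \<or> pin_in_dir D S l q"
      unfolding bbox_sides[OF T] pin_in_dir_def letter.case using True by blast
    then show ?thesis by blast
  next
    case False
    then have h: "sep_h q {l} S" using assms(3) by (auto simp: separates_def)
    then have "Max (fst ` ?T) < fst q \<or> fst q < Min (fst ` ?T)"
      using sep_h_within_bbox[OF assms(1,2) h] out by linarith
    then have "pin_in_dir R S l q \<or> pin_in_dir L S l q"
      unfolding bbox_sides[OF T] pin_in_dir_def letter.case using h by blast
    then show ?thesis by blast
  qed
qed

section \<open>Chains of separating pins\<close>

text \<open>
  Only the values \<open>d 2, \<dots>, d n\<close> matter. The pin \<open>p 0\<close> plays the role of the origin of a strict pin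
  word, or of the first pin of a quasi-strict one.
\<close>

definition pin_chain :: "letter \<Rightarrow> (nat \<Rightarrow> letter) \<Rightarrow> (nat \<Rightarrow> pin) \<Rightarrow> nat \<Rightarrow> bool" where
  "pin_chain a d p n \<longleftrightarrow> in_quadrant a {p 0} (p 1) \<and>
     (\<forall>k. 2 \<le> k \<and> k \<le> n \<longrightarrow> pin_in_dir (d k) (p ` {..<k - 1}) (p (k - 1)) (p k))"

lemma pin_chainD:
  assumes "pin_chain a d p n" "2 \<le> k" "k \<le> n"
  shows "pin_in_dir (d k) (p ` {..<k - 1}) (p (k - 1)) (p k)"
  using assms by (simp add: pin_chain_def)

text \<open>Shared by chains and pin words, which differ only in where numerals may occur: a
  quadrant link and a direction link both forbid a common row or column with an older pin.\<close>

lemma coords_neq_of_links: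
  fixes p :: "nat \<Rightarrow> pin"
  assumes "\<And>k. 1 \<le> k \<Longrightarrow> k \<le> n \<Longrightarrow>
      (\<exists>a. in_quadrant a (p ` {..<k}) (p k)) \<or> (\<exists>d. pin_in_dir d (p ` {..<k - 1}) (p (k - 1)) (p k))"
    and "i \<le> n" "j \<le> n" "i \<noteq> j"
  shows "fst (p i) \<noteq> fst (p j) \<and> snd (p i) \<noteq> snd (p j)"
proof -
  have *: "fst (p i) \<noteq> fst (p j) \<and> snd (p i) \<noteq> snd (p j)" if "i < j" "j \<le> n" for i j
  proof -
    have "1 \<le> j" using that(1) by simp
    from assms(1)[OF this that(2)] show ?thesis
    proof (elim disjE exE)
      fix a assume "in_quadrant a (p ` {..<j}) (p j)"
      then show ?thesis using in_quadrant_coords_neq that(1) by blast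
    next
      fix d assume d: "pin_in_dir d (p ` {..<j - 1}) (p (j - 1)) (p j)"
      have "p i \<in> insert (p (j - 1)) (p ` {..<j - 1})"
        using that(1) by (cases "i = j - 1") auto
      then show ?thesis using pin_in_dir_coords_neq[OF d] by blast
    qed
  qed
  show ?thesis using *[of i j] *[of j i] assms(2-4) by (cases "i < j") auto
qed

lemma pin_chain_coords_neq:
  assumes "pin_chain a d p n" "i \<le> n" "j \<le> n" "i \<noteq> j"
  shows "fst (p i) \<noteq> fst (p j) \<and> snd (p i) \<noteq> snd (p j)"
proof (rule coords_neq_of_links[OF _ assms(2-4)])
  fix k assume "1 \<le> k" "k \<le> n"
  then show "(\<exists>a. in_quadrant a (p ` {..<k}) (p k)) \<or>
      (\<exists>d. pin_in_dir d (p ` {..<k - 1}) (p (k - 1)) (p k))"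
  proof (cases "k = 1")
    case True
    then have "p ` {..<k} = {p 0}" by (auto simp: lessThan_Suc)
    then show ?thesis using assms(1) True by (auto simp: pin_chain_def)
  next
    case False
    then have "2 \<le> k" using \<open>1 \<le> k\<close> by simp
    then show ?thesis using pin_chainD[OF assms(1) _ \<open>k \<le> n\<close>] by blast
  qed
qed

text \<open>With an empty second set, separation merely says that the transversal coordinates
  differ. The conclusion is thus the comparison of \<open>q\<close> with one older pin: it lies on
  side \<open>d\<close> of \<open>x\<close>.\<close>

lemma pin_in_dir_halfplane:
  assumes "pin_in_dir d S l q" "x \<in> insert l S"
  shows "pin_in_dir d {} x q"
  using pin_in_dir_coords_neq[OF assms] assms unfolding pin_in_dir_def sep_h_def sep_v_def
  by (cases d; simp only: letter.case; auto)

text \<open>On the axis of \<open>c\<close>, \<open>q\<close> runs between \<open>x\<close> and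
  \<open>l\<close>; since \<open>l\<close> is on side \<open>c\<close> of \<open>x\<close>, so is
  \<open>q\<close>. Direction \<open>d\<close> settles the other axis.\<close>

lemma in_quadrant_of_two_dirs:
  assumes "pin_in_dir c {} x l" "pin_in_dir d {x} l q" "quadrant_of b c d"
  shows "in_quadrant b {x} q"
  using assms unfolding quadrant_of_cases
  by (auto simp: pin_in_dir_def sep_h_def sep_v_def in_quadrant_def)

text \<open>\<open>o1\<close> and \<open>o2\<close> are reference pins. The new pin cuts
  \<open>l\<close> off from all older pins, so the side of \<open>l\<close> on which it runs is
  known once \<open>l\<close> is compared with a single older pin.\<close>

lemma pin_in_dir_order_unique:
  assumes "pin_in_dir d {o1, x1} l1 q1" "pin_in_dir d {o2, x2} l2 q2"
    "fst l1 < fst o1 \<longleftrightarrow> fst l2 < fst o2" "snd l1 < snd o1 \<longleftrightarrow> snd l2 < snd o2"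
    "y1 = x1 \<and> y2 = x2 \<or> y1 = l1 \<and> y2 = l2"
  shows "(fst y1 < fst q1 \<longleftrightarrow> fst y2 < fst q2) \<and> (fst q1 < fst y1 \<longleftrightarrow> fst q2 < fst y2) \<and>
     (snd y1 < snd q1 \<longleftrightarrow> snd y2 < snd q2) \<and> (snd q1 < snd y1 \<longleftrightarrow> snd q2 < snd y2)"
  using assms(5)
proof (elim disjE conjE)
  assume "y1 = x1" "y2 = x2"
  then show ?thesis using assms(1-4)
    by (cases d; simp add: pin_in_dir_def sep_h_def sep_v_def; elim conjE disjE; simp)
next
  assume "y1 = l1" "y2 = l2"
  then show ?thesis using assms(1-4)
    by (cases d; simp add: pin_in_dir_def sep_h_def sep_v_def; elim conjE disjE; simp)
qed

lemma pin_chain_order_unique: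
  assumes "pin_chain a d p n" "pin_chain a d q n" "i \<le> n" "j \<le> n"
  shows "(fst (p i) < fst (p j) \<longleftrightarrow> fst (q i) < fst (q j)) \<and>
         (snd (p i) < snd (p j) \<longleftrightarrow> snd (q i) < snd (q j))"
  using assms
proof (induction n arbitrary: i j)
  case 0
  then show ?case by simp
next
  case (Suc n)
  have IH: "(fst (p i) < fst (p j) \<longleftrightarrow> fst (q i) < fst (q j)) \<and>
         (snd (p i) < snd (p j) \<longleftrightarrow> snd (q i) < snd (q j))" if "i \<le> n" "j \<le> n" for i j
    using Suc.IH[OF _ _ that] Suc.prems(1,2) by (auto simp: pin_chain_def)
  have new: "(fst (p i) < fst (p (Suc n)) \<longleftrightarrow> fst (q i) < fst (q (Suc n))) \<and>
     (fst (p (Suc n)) < fst (p i) \<longleftrightarrow> fst (q (Suc n)) < fst (q i)) \<and>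
     (snd (p i) < snd (p (Suc n)) \<longleftrightarrow> snd (q i) < snd (q (Suc n))) \<and>
     (snd (p (Suc n)) < snd (p i) \<longleftrightarrow> snd (q (Suc n)) < snd (q i))" if i: "i \<le> n" for i
  proof (cases "n = 0")
    case True
    then have "in_quadrant a {p 0} (p (Suc n))" "in_quadrant a {q 0} (q (Suc n))" "i = 0"
      using Suc.prems(1,2) i by (auto simp: pin_chain_def)
    then show ?thesis by (cases a) (auto simp: in_quadrant_def)
  next
    case False
    have P: "pin_in_dir (d (Suc n)) (p ` {..<n}) (p n) (p (Suc n))"
      and Q: "pin_in_dir (d (Suc n)) (q ` {..<n}) (q n) (q (Suc n))"
      using pin_chainD[OF Suc.prems(1), of "Suc n"] pin_chainD[OF Suc.prems(2), of "Suc n"] False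
        by auto
    \<comment> \<open>Pin 0 is the reference pin. For \<open>i = n\<close> the second pin of the set
      is a dummy, and the comparison is with the last pin.\<close>
    have P0: "pin_in_dir (d (Suc n)) {p 0, p (if i < n then i else 0)} (p n) (p (Suc n))"
      and Q0: "pin_in_dir (d (Suc n)) {q 0, q (if i < n then i else 0)} (q n) (q (Suc n))"
      using False by (auto intro!: pin_in_dir_mono[OF P] pin_in_dir_mono[OF Q])
    show ?thesis
      by (rule pin_in_dir_order_unique[OF P0 Q0]) (use IH[of n 0] i in auto)
  qed
  show ?case
    using Suc.prems(3,4) IH[of i j] new[of i] new[of j]
      by (cases "i = Suc n"; cases "j = Suc n") auto
qed

text \<open>The argument with two directions applies to each pin at least two steps older. The bound
  \<open>3 \<le> i\<close> reflects that letters start at index 2 and that \<open>d (i - 1)\<close>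
  is read.\<close>

lemma pin_chain_in_quadrant:
  assumes "pin_chain a d p n" "3 \<le> i" "i \<le> n" "quadrant_of b (d (i - 1)) (d i)"
  shows "in_quadrant b (p ` {..<i - 1}) (p i)"
proof -
  have P: "pin_in_dir (d i) (p ` {..<i - 1}) (p (i - 1)) (p i)"
    using pin_chainD[OF assms(1)] assms(2,3) by auto
  have Q: "pin_in_dir (d (i - 1)) (p ` {..<i - 1 - 1}) (p (i - 1 - 1)) (p (i - 1))"
    using pin_chainD[OF assms(1), of "i - 1"] assms(2,3) by auto
  have "in_quadrant b {x} (p i)" if x: "x \<in> p ` {..<i - 1}" for x
  proof -
    have "x \<in> insert (p (i - 1 - 1)) (p ` {..<i - 1 - 1})"
    proof -
      obtain m where m: "x = p m" "m < i - 1" using x by auto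
      then show ?thesis by (cases "m = i - 1 - 1") auto
    qed
    from in_quadrant_of_two_dirs[OF pin_in_dir_halfplane[OF Q this] pin_in_dir_mono[OF P] assms(4)]
    show ?thesis using x by blast
  qed
  moreover have "b \<in> numerals" using assms(4) by (auto simp: quadrant_of_cases numerals_def)
  ultimately show ?thesis
    unfolding in_quadrant_def numerals_def by (elim insertE emptyE; simp only: letter.case; blast)
qed

text \<open>Every pin \<open>h\<close> at least two steps older than \<open>i\<close> may precede
  the run from \<open>i\<close> on: it sees pin \<open>i\<close> in the quadrant spelled by the
  letters \<open>i - 1\<close> and \<open>i\<close>, and the later links persist by
  monotonicity.\<close>

lemma pin_chain_subchain:
  assumes "pin_chain a d p n" "3 \<le> i" "h + 2 \<le> i" "i + m \<le> n + 1" "1 \<le> m"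
    "quadrant_of b (d (i - 1)) (d i)"
  shows "pin_chain b (\<lambda>k. d (i + k - 1)) (\<lambda>k. if k = 0 then p h else p (i + k - 1)) m"
  unfolding pin_chain_def
proof (intro conjI allI impI)
  have "in_quadrant b (p ` {..<i - 1}) (p i)"
    using pin_chain_in_quadrant[OF assms(1,2) _ assms(6)] assms by auto
  then show "in_quadrant b {if (0::nat) = 0 then p h else p (i + 0 - 1)} (if (1::nat) = 0 then p h else p (i + 1 - 1))"
    using assms(3) by (auto elim!: in_quadrant_mono)
next
  fix k assume k: "2 \<le> k \<and> k \<le> m"
  let ?r = "\<lambda>k. if k = 0 then p h else p (i + k - 1)"
  have "pin_in_dir (d (i + k - 1)) (p ` {..<i + k - 1 - 1}) (p (i + k - 1 - 1)) (p (i + k - 1))"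
    using k assms by (intro pin_chainD[OF assms(1)]) auto
  moreover have "?r ` {..<k - 1} \<subseteq> p ` {..<i + k - 1 - 1}" using assms k by auto
  moreover have "i + (k - 1) - 1 = i + k - 1 - 1" using k by auto
  ultimately show "pin_in_dir (d (i + k - 1)) (?r ` {..<k - 1}) (?r (k - 1)) (?r k)"
    using k by (auto intro: pin_in_dir_mono)
qed

text \<open>Were both directions vertical, the column of pin \<open>k\<close> would lie between
  those of \<open>p 0\<close> and \<open>p (k - 1)\<close>, and no vertical line could cut off pin
  \<open>k\<close> from both. Rows behave alike.\<close>

lemma pin_chain_alternates:
  assumes "pin_chain a d p n" "2 \<le> k" "k < n"
  shows "horiz (d k) \<longleftrightarrow> vert (d (Suc k))"
proof -
  have P: "pin_in_dir (d k) {p 0} (p (k - 1)) (p k)"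
    using pin_chainD[OF assms(1), of k] assms(2,3) by (auto elim!: pin_in_dir_mono)
  have Q: "pin_in_dir (d (Suc k)) {p 0, p (k - 1)} (p k) (p (Suc k))"
    using pin_chainD[OF assms(1), of "Suc k"] assms(2,3) by (auto elim!: pin_in_dir_mono)
  show ?thesis using P Q
    by (cases "d k"; cases "d (Suc k)") (auto simp: pin_in_dir_def sep_h_def sep_v_def horiz_def vert_def)
qed

section \<open>Explicit coordinates for an alternating word\<close>

definition pin_sign :: "letter \<Rightarrow> int" where
  "pin_sign c = (if c = U \<or> c = R then 1 else - 1)"

text \<open>
  The coordinate \<open>2k + 2\<close> exceeds all earlier ones in absolute value, while \<open>2k - 1\<close> lies strictly
  between \<open>2k\<close>, reached by pin \<open>k - 1\<close>, and the bound \<open>2k - 2\<close> for all pins before it.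
\<close>

definition spiral_pin :: "letter list \<Rightarrow> nat \<Rightarrow> pin" where
  "spiral_pin w k =
     (if k = 0 then (0, 0)
      else if vert (w ! k) then (pin_sign (w ! (k - 1)) * (2 * int k - 1), pin_sign (w ! k) * (2 * int k + 2))
      else (pin_sign (w ! k) * (2 * int k + 2), pin_sign (w ! (k - 1)) * (2 * int k - 1)))"

lemma spiral_pin_bound:
  "\<bar>fst (spiral_pin w k)\<bar> \<le> 2 * int k + 2 \<and> \<bar>snd (spiral_pin w k)\<bar> \<le> 2 * int k + 2"
  by (auto simp: spiral_pin_def pin_sign_def)

lemma pin_in_dir_spiral:
  assumes "vert (w ! l) \<and> horiz (w ! Suc l) \<or> horiz (w ! l) \<and> vert (w ! Suc l)" "1 \<le> l"
    and "\<And>x. x \<in> S \<Longrightarrow> \<bar>fst x\<bar> \<le> 2 * int (Suc l) - 2 \<and> \<bar>snd x\<bar> \<le> 2 * int (Suc l) - 2"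
  shows "pin_in_dir (w ! Suc l) S (spiral_pin w l) (spiral_pin w (Suc l))"
proof -
  \<comment> \<open>The coordinates of the new pin have absolute values \<open>2 * l + 1\<close> and
    \<open>2 * l + 4\<close>, so these are all the comparisons with older pins that can
    occur.\<close>
  have S: "- (2 * int l + 1) < fst x" "fst x < 2 * int l + 1" "- (2 * int l + 1) < snd x" "snd x < 2 * int l + 1"
    "- (2 * int l + 4) < fst x" "fst x < 2 * int l + 4" "- (2 * int l + 4) < snd x" "snd x < 2 * int l + 4"
    if "x \<in> S" for x
    using assms(3)[OF that] by auto
  have *: "2 * int (Suc l) - 1 = 2 * int l + 1" "2 * int (Suc l) + 2 = 2 * int l + 4" by auto
  from assms(1) show ?thesis
    unfolding horiz_def vert_def
    apply (elim disjE conjE)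
    using S assms(2)
    by (simp_all add: spiral_pin_def vert_def pin_sign_def pin_in_dir_def sep_h_def sep_v_def * del: of_nat_Suc)
qed

lemma pin_chain_spiral:
  assumes "alternating w" "2 \<le> length w"
  shows "\<exists>a. pin_chain a (\<lambda>k. w ! k) (spiral_pin w) (length w - 1)"
proof -
  have dirs: "w ! k \<in> directions" if "k < length w" for k
    using assms(1) that by (auto simp: alternating_def)
  have alt: "horiz (w ! k) \<longleftrightarrow> vert (w ! Suc k)" if "Suc k < length w" for k
    using assms(1) that by (auto simp: alternating_def)
  \<comment> \<open>Pin 1 has coordinates of absolute values 1 and 4, so it lies in some quadrant of
    the origin.\<close>
  have "fst (spiral_pin w 0) \<noteq> fst (spiral_pin w 1)" "snd (spiral_pin w 0) \<noteq> snd (spiral_pin w 1)"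
    by (auto simp: spiral_pin_def pin_sign_def)
  then obtain a where "in_quadrant a {spiral_pin w 0} (spiral_pin w 1)"
    using ex_in_quadrant by blast
  moreover have "pin_in_dir (w ! k) (spiral_pin w ` {..<k - 1}) (spiral_pin w (k - 1)) (spiral_pin w k)"
    if k: "2 \<le> k" "k < length w" for k
  proof -
    have small: "\<bar>fst x\<bar> \<le> 2 * int k - 2 \<and>
        \<bar>snd x\<bar> \<le> 2 * int k - 2" if x: "x \<in> spiral_pin w ` {..<k - 1}" for x
    proof -
      obtain m where "x = spiral_pin w m" "m < k - 1" using x by auto
      moreover have "2 * int m + 2 \<le> 2 * int k - 2" using \<open>m < k - 1\<close> by linarith
      ultimately show ?thesis using spiral_pin_bound[of w m] by auto
    qed
    obtain l where l: "k = Suc l" "1 \<le> l" using k by (cases k) auto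
    have "vert (w ! l) \<and> horiz (w ! k) \<or> horiz (w ! l) \<and> vert (w ! k)"
      using dirs[of k] dirs[of l] alt[of l] k l by (auto simp: directions_def horiz_def vert_def)
    then show ?thesis
      using pin_in_dir_spiral[OF _ l(2), of w "spiral_pin w ` {..<k - 1}"] small unfolding l(1)
        by simp
  qed
  ultimately show ?thesis using assms(2) by (auto simp: pin_chain_def)
qed

section \<open>Pin words and patterns as point sets\<close>

lemma set_take_map_upt:
  "k \<le> m \<Longrightarrow> set (take k (map r [0..<m])) = r ` {..<k}"
  by (simp add: take_map atLeast0LessThan)

lemma pin_seq_map:
  fixes r :: "nat \<Rightarrow> pin"
  assumes "\<And>k. 1 \<le> k \<Longrightarrow> k < m \<Longrightarrow>
      (\<exists>a. in_quadrant a (r ` {..<k}) (r k)) \<or> (\<exists>d. pin_in_dir d (r ` {..<k - 1}) (r (k - 1)) (r k))"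
  shows "pin_seq (map r [0..<m])"
  unfolding pin_seq_def
proof (intro conjI allI impI)
  fix i j assume ij: "i < length (map r [0..<m])" "j < length (map r [0..<m])" "i \<noteq> j"
  have "fst (r i) \<noteq> fst (r j) \<and> snd (r i) \<noteq> snd (r j)"
    by (rule coords_neq_of_links[of "m - 1" r]) (use ij assms in auto)
  then show "fst (map r [0..<m] ! i) \<noteq> fst (map r [0..<m] ! j)" "snd (map r [0..<m] ! i) \<noteq> snd (map r [0..<m] ! j)"
    using ij by auto
next
  fix k assume "1 \<le> k \<and> k < length (map r [0..<m])"
  then have k: "1 \<le> k" "k < m" by auto
  have ins: "r ` {..<k} = insert (r (k - 1)) (r ` {..<k - 1})"
  proof -
    have "{..<k} = insert (k - 1) {..<k - 1}" using k(1) by auto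
    then show ?thesis by simp
  qed
  have *: "map r [0..<m] ! k = r k" "map r [0..<m] ! (k - 1) = r (k - 1)"
    "set (take k (map r [0..<m])) = r ` {..<k}" "set (take (k - 1) (map r [0..<m])) = r ` {..<k - 1}"
    using k by (auto simp: set_take_map_upt simp del: take_map)
  have ne: "r ` {..<k} \<noteq> {}" unfolding ins by blast
  from assms[OF k] have "\<not> in_bbox (r k) (r ` {..<k}) \<and>
     (separates (r k) {r (k - 1)} (r ` {..<k - 1}) \<or> independent (r k) (r ` {..<k}))"
  proof (elim disjE exE)
    fix a assume "in_quadrant a (r ` {..<k}) (r k)"
    then show ?thesis using in_quadrant_outside_bbox[OF _ ne] in_quadrant_independent by blast
  next
    fix d assume "pin_in_dir d (r ` {..<k - 1}) (r (k - 1)) (r k)"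
    then show ?thesis unfolding ins using pin_in_dir_outside_bbox pin_in_dir_separates by blast
  qed
  then show "\<not> in_bbox (map r [0..<m] ! k) (set (take k (map r [0..<m])))"
    "separates (map r [0..<m] ! k) {map r [0..<m] ! (k - 1)} (set (take (k - 1) (map r [0..<m]))) \<or>
     independent (map r [0..<m] ! k) (set (take k (map r [0..<m])))"
    unfolding * by blast+
qed

text \<open>Index 0 is the origin, so the permutation lives on \<open>{1..n}\<close> and position
  \<open>k\<close> of the word describes pin \<open>Suc k\<close>. A direction requires
  \<open>2 \<le> k\<close>, since otherwise there is nothing from which the predecessor could be cut
  off.\<close>

lemma pin_word_of_map:
  assumes "\<And>k. 1 \<le> k \<Longrightarrow> k \<le> n \<Longrightarrow> in_quadrant (c k) (r ` {..<k}) (r k) \<or>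
      2 \<le> k \<and> pin_in_dir (c k) (r ` {..<k - 1}) (r (k - 1)) (r k)"
    and "order_iso_pts (r ` {1..n}) (diagram \<pi>)"
  shows "pin_word_of (map (\<lambda>k. c (Suc k)) [0..<n]) \<pi>"
proof -
  let ?ps = "map (\<lambda>k. r (Suc k)) [0..<n]"
  have link: "in_quadrant (c (Suc k)) (r ` {..<Suc k}) (r (Suc k)) \<or>
      1 \<le> k \<and> pin_in_dir (c (Suc k)) (r ` {..<k}) (r k) (r (Suc k))" if "k < n" for k
    using assms(1)[of "Suc k"] that by simp
  have cons: "r 0 # ?ps = map r [0..<Suc n]"
    using map_upt_Suc[of r n] by simp
  have "pin_seq (r 0 # ?ps)" unfolding cons by (rule pin_seq_map) (use assms(1) in fastforce)
  moreover have "pin_seq ?ps"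
  proof (rule pin_seq_map)
    fix k assume k: "1 \<le> k" "k < n"
    have sub: "(\<lambda>k. r (Suc k)) ` {..<k} \<subseteq> r ` {..<Suc k}" "(\<lambda>k. r (Suc k)) ` {..<k - 1} \<subseteq> r ` {..<k}" by auto
    have k': "Suc (k - 1) = k" using k by simp
    show "(\<exists>a. in_quadrant a ((\<lambda>k. r (Suc k)) ` {..<k}) (r (Suc k))) \<or>
      (\<exists>d. pin_in_dir d ((\<lambda>k. r (Suc k)) ` {..<k - 1}) (r (Suc (k - 1))) (r (Suc k)))"
      unfolding k' using link[OF k(2)] in_quadrant_mono[OF _ sub(1)] pin_in_dir_mono[OF _ sub(2)]
        by blast
  qed
  moreover have "set ?ps = r ` {1..n}"
  proof -
    have "{1..n} = Suc ` {0..<n}"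
      by (simp add: image_Suc_atLeastLessThan atLeastLessThanSuc_atLeastAtMost)
    then show ?thesis by (simp only: image_image set_map set_upt)
  qed
  ultimately have "pin_rep ?ps \<pi>" "pin_seq (r 0 # ?ps)" using assms(2) by (auto simp: pin_rep_def)
  moreover have "encodes (take (i + 1) (r 0 # ?ps)) (?ps ! i) (map (\<lambda>k. c (Suc k)) [0..<n] ! i)" if i: "i < n" for i
  proof -
    have t: "take (i + 1) (r 0 # ?ps) = map r [0..<i] @ [r i]"
      unfolding cons using i by (simp add: take_map del: upt_Suc) simp
    have s: "set (map r [0..<i] @ [r i]) = r ` {..<Suc i}" by (auto simp: lessThan_Suc)
    have "encodes (map r [0..<i] @ [r i]) (r (Suc i)) (c (Suc i))"
      using link[OF i]
    proof (elim disjE)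
      assume q: "in_quadrant (c (Suc i)) (r ` {..<Suc i}) (r (Suc i))"
      then show ?thesis
        using encodes_numeral_iff[OF _ in_quadrant_imp_numeral[OF q], of "map r [0..<i] @ [r i]" "r (Suc i)"] s by simp
    next
      assume d: "1 \<le> i \<and> pin_in_dir (c (Suc i)) (r ` {..<i}) (r i) (r (Suc i))"
      then have "butlast (map r [0..<i] @ [r i]) \<noteq> []" by auto
      from encodes_direction_iff[OF this pin_in_dir_imp_direction[OF conjunct2[OF d]], of "r (Suc i)"] d show ?thesis
        by (simp add: atLeast0LessThan)
    qed
    then show ?thesis unfolding t using i by simp
  qed
  ultimately show ?thesis unfolding pin_word_of_def by (intro exI[of _ ?ps] exI[of _ "r 0"]) auto
qed

lemma pin_word_of_link:
  assumes "pin_word_of u \<pi>"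
  obtains p where "pin_rep (map (\<lambda>k. p (Suc k)) [0..<length u]) \<pi>"
    and "\<And>k. k < length u \<Longrightarrow> u ! k \<in> numerals \<Longrightarrow> in_quadrant (u ! k) (p ` {..<Suc k}) (p (Suc k))"
    and "\<And>k. 1 \<le> k \<Longrightarrow> k < length u \<Longrightarrow> u ! k \<in> directions \<Longrightarrow>
        pin_in_dir (u ! k) (p ` {..<k}) (p k) (p (Suc k))"
proof -
  obtain ps p0 where ps: "pin_rep ps \<pi>" "length u = length ps"
    and enc: "\<And>i. i < length ps \<Longrightarrow> encodes (take (i + 1) (p0 # ps)) (ps ! i) (u ! i)"
    using assms unfolding pin_word_of_def by blast
  define p where "p k = (p0 # ps) ! k" for k
  have ps_map: "map (\<lambda>k. p (Suc k)) [0..<length u] = ps"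
    unfolding p_def ps(2) by (simp add: map_nth)
  have t: "take (k + 1) (p0 # ps) = map p [0..<k] @ [p k]" if "k < length u" for k
  proof (rule nth_equalityI)
    fix i assume "i < length (take (k + 1) (p0 # ps))"
    then have "i < Suc k" by simp
    then show "take (k + 1) (p0 # ps) ! i = (map p [0..<k] @ [p k]) ! i"
      by (cases "i = k") (auto simp: p_def nth_append simp del: take_Suc_Cons)
  qed (use that ps(2) in simp)
  show ?thesis
  proof (rule that[of p])
    show "pin_rep (map (\<lambda>k. p (Suc k)) [0..<length u]) \<pi>" using ps ps_map by simp
  next
    fix k assume k: "k < length u" "u ! k \<in> numerals"
    have "set (map p [0..<k] @ [p k]) = p ` {..<Suc k}" by (auto simp: lessThan_Suc)
    then show "in_quadrant (u ! k) (p ` {..<Suc k}) (p (Suc k))"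
      using enc[of k] k ps(2) encodes_numeral_iff[of "map p [0..<k] @ [p k]" "u ! k" "ps ! k"]
      by (simp only: t) (simp add: p_def)
  next
    fix k assume k: "1 \<le> k" "k < length u" "u ! k \<in> directions"
    then have "butlast (map p [0..<k] @ [p k]) \<noteq> []" by auto
    from encodes_direction_iff[OF this k(3), of "p (Suc k)"] enc[of k] k ps(2) t[of k]
    show "pin_in_dir (u ! k) (p ` {..<k}) (p k) (p (Suc k))"
      by (simp add: p_def atLeast0LessThan)
  qed
qed

text \<open>The isomorphism sends \<open>p k\<close> to \<open>q k\<close>; it is well defined
  because the pins of a chain are distinct.\<close>

lemma order_iso_pts_pin_chain:
  assumes "pin_chain a d p n" "pin_chain a d q n" "K \<subseteq> {..n}"
  shows "order_iso_pts (p ` K) (q ` K)"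
proof -
  have inj: "inj_on p K" "inj_on q K"
    using pin_chain_coords_neq[OF assms(1)] pin_chain_coords_neq[OF assms(2)] assms(3)
    unfolding inj_on_def subset_iff atMost_iff by metis+
  let ?f = "\<lambda>x. q (the_inv_into K p x)"
  have f: "?f (p k) = q k" if "k \<in> K" for k using that inj(1) by (simp add: the_inv_into_f_f)
  have "bij_betw ?f (p ` K) (q ` K)"
    unfolding bij_betw_def
  proof
    show "inj_on ?f (p ` K)" using inj(2) f by (auto simp: inj_on_def)
    show "?f ` p ` K = q ` K" unfolding image_image using f by (intro image_cong) auto
  qed
  then show ?thesis unfolding order_iso_pts_def
    using pin_chain_order_unique[OF assms(1,2)] f assms(3)
      by (intro exI[of _ ?f]) (auto simp: subset_iff)
qed

section \<open>Order isomorphism of point sets and pattern containment\<close>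

lemma order_iso_pts_sym: "order_iso_pts S T \<Longrightarrow> order_iso_pts T S"
  unfolding order_iso_pts_def
proof (elim exE conjE)
  fix f assume f: "bij_betw f S T"
    and o: "\<forall>p\<in>S. \<forall>q\<in>S. (fst p < fst q) = (fst (f p) < fst (f q)) \<and>
        (snd p < snd q) = (snd (f p) < snd (f q))"
  let ?g = "inv_into S f"
  have g: "bij_betw ?g T S" using f by (rule bij_betw_inv_into)
  moreover have "?g p \<in> S" "f (?g p) = p" if "p \<in> T" for p
    using that f g by (auto simp: bij_betw_inv_into_right bij_betwE)
  ultimately show "\<exists>g. bij_betw g T S \<and>
      (\<forall>p\<in>T. \<forall>q\<in>T. (fst p < fst q) = (fst (g p) < fst (g q)) \<and> (snd p < snd q) = (snd (g p) < snd (g q)))"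
    using o by (intro exI[of _ ?g]) auto
qed

lemma order_iso_pts_trans: "order_iso_pts S T \<Longrightarrow> order_iso_pts T V \<Longrightarrow> order_iso_pts S V"
  unfolding order_iso_pts_def
proof (elim exE conjE)
  fix f g assume f: "bij_betw f S T" "\<forall>p\<in>S. \<forall>q\<in>S. (fst p < fst q) = (fst (f p) < fst (f q)) \<and>
      (snd p < snd q) = (snd (f p) < snd (f q))"
   and g: "bij_betw g T V" "\<forall>p\<in>T. \<forall>q\<in>T. (fst p < fst q) = (fst (g p) < fst (g q)) \<and>
       (snd p < snd q) = (snd (g p) < snd (g q))"
  have "f p \<in> T" if "p \<in> S" for p using f(1) that by (rule bij_betwE[rule_format])
  then show "\<exists>h. bij_betw h S V \<and> (\<forall>p\<in>S. \<forall>q\<in>S. (fst p < fst q) = (fst (h p) < fst (h q)) \<and>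
      (snd p < snd q) = (snd (h p) < snd (h q)))"
    using bij_betw_trans[OF f(1) g(1)] f(2) g(2) by (intro exI[of _ "g \<circ> f"]) auto
qed

lemma order_iso_pts_subset:
  assumes "order_iso_pts S T" "S' \<subseteq> S"
  shows "\<exists>T'\<subseteq>T. order_iso_pts S' T'"
proof -
  obtain f where f: "bij_betw f S T" "\<forall>p\<in>S. \<forall>q\<in>S. (fst p < fst q) = (fst (f p) < fst (f q)) \<and>
      (snd p < snd q) = (snd (f p) < snd (f q))"
    using assms(1) unfolding order_iso_pts_def by blast
  have "bij_betw f S' (f ` S')" using f(1) assms(2) bij_betw_subset by blast
  then have "order_iso_pts S' (f ` S')" unfolding order_iso_pts_def using f(2) assms(2)
    by (intro exI[of _ f]) auto
  moreover have "f ` S' \<subseteq> T" using f(1) assms(2) by (auto simp: bij_betw_def)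
  ultimately show ?thesis by blast
qed

lemma order_iso_pts_card: "order_iso_pts S T \<Longrightarrow> card S = card T"
  unfolding order_iso_pts_def using bij_betw_same_card by blast

lemma subseq_iff_index_map:
  "subseq xs ys \<longleftrightarrow> (\<exists>h. (\<forall>i<length xs. h i < length ys \<and> xs ! i = ys ! h i) \<and>
     (\<forall>i j. i < j \<and> j < length xs \<longrightarrow> h i < h j))" (is "_ \<longleftrightarrow> ?R xs ys")
proof
  assume "subseq xs ys"
  then show "?R xs ys"
  proof (induction rule: list_emb.induct)
    case (list_emb_Nil ys)
    then show ?case by auto
  next
    case (list_emb_Cons xs ys y)
    then obtain h
      where h: "\<forall>i<length xs. h i < length ys \<and> xs ! i = ys ! h i" "\<forall>i j. i < j \<and>
          j < length xs \<longrightarrow> h i < h j" by blast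
    then show ?case by (intro exI[of _ "\<lambda>i. Suc (h i)"]) auto
  next
    case (list_emb_Cons2 x y xs ys)
    then obtain h
      where h: "\<forall>i<length xs. h i < length ys \<and> xs ! i = ys ! h i" "\<forall>i j. i < j \<and>
          j < length xs \<longrightarrow> h i < h j" by blast
    then show ?case using list_emb_Cons2(1)
      by (intro exI[of _ "\<lambda>i. case i of 0 \<Rightarrow> 0 | Suc k \<Rightarrow> Suc (h k)"]) (auto simp: nth_Cons split: nat.split)
  qed
next
  assume "?R xs ys"
  then show "subseq xs ys"
  proof (induction xs arbitrary: ys)
    case Nil
    then show ?case by simp
  next
    case (Cons x xs)
    then obtain h where h: "\<forall>i<Suc (length xs). h i < length ys \<and> (x # xs) ! i = ys ! h i"
      "\<forall>i j. i < j \<and> j < Suc (length xs) \<longrightarrow> h i < h j" by auto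
    let ?zs = "drop (Suc (h 0)) ys"
    have h0: "h 0 < length ys" "x = ys ! h 0" using h(1) by force+
    have gt: "h 0 < h (Suc i)" if "i < length xs" for i using h(2) that by auto
    have "subseq xs ?zs"
    proof (rule Cons.IH, intro exI[of _ "\<lambda>i. h (Suc i) - Suc (h 0)"] conjI allI impI)
      fix i assume i: "i < length xs"
      have "h (Suc i) < length ys" "xs ! i = ys ! h (Suc i)" using h(1) i by force+
      then show "h (Suc i) - Suc (h 0) < length ?zs" "xs ! i = ?zs ! (h (Suc i) - Suc (h 0))"
        using gt[OF i] by auto
    next
      fix i j assume ij: "i < j \<and> j < length xs"
      then have "h (Suc i) < h (Suc j)" using h(2) by auto
      then show "h (Suc i) - Suc (h 0) < h (Suc j) - Suc (h 0)" using gt[of i] ij by auto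
    qed
    moreover have "ys = take (h 0) ys @ x # ?zs" using h0 by (simp add: id_take_nth_drop)
    ultimately show ?case by (metis list_emb_append2 subseq_Cons2)
  qed
qed

text \<open>Positions are abscissae, so preserving the order of \<open>fst\<close> means that the
  index map of the subsequence increases, and preserving \<open>snd\<close> is order isomorphism of
  the values.\<close>

lemma contains_iff_pts:
  "contains \<pi> \<sigma> \<longleftrightarrow> (\<exists>T\<subseteq>diagram \<sigma>. order_iso_pts T (diagram \<pi>))"
proof
  assume "contains \<pi> \<sigma>"
  then obtain \<tau> where \<tau>: "subseq \<tau> \<sigma>" "order_iso_list \<pi> \<tau>" by (auto simp: contains_def)
  obtain h where h: "\<And>i. i < length \<tau> \<Longrightarrow> h i < length \<sigma> \<and> \<tau> ! i = \<sigma> ! h i" "\<And>i j. i < j \<Longrightarrow>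
      j < length \<tau> \<Longrightarrow> h i < h j"
    using \<tau>(1) unfolding subseq_iff_index_map by blast
  have len: "length \<tau> = length \<pi>" using \<tau>(2) by (simp add: order_iso_list_def)
  have hm: "h i < h j \<longleftrightarrow> i < j" if "i < length \<pi>" "j < length \<pi>" for i j
    using h(2)[of i j] h(2)[of j i] that len by (cases i j rule: linorder_cases) auto
  have hm_int: "int (h i) + 1 \<le> int (h j) \<longleftrightarrow> i < j" if "i < length \<pi>" "j < length \<pi>" for i j
    using hm[OF that] by linarith
  \<comment> \<open>Diagram columns count from 1 and list positions from 0; this undoes the
    shift.\<close>
  have idx: "nat (1 + int i) - Suc 0 = i" for i by simp
  let ?f = "\<lambda>x. (int (h (nat (fst x) - 1)) + 1, int (\<sigma> ! h (nat (fst x) - 1)))"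
  let ?T = "?f ` diagram \<pi>"
  have "inj_on ?f (diagram \<pi>)"
  proof (rule inj_onI)
    fix x y assume "x \<in> diagram \<pi>" "y \<in> diagram \<pi>" "?f x = ?f y"
    then obtain i j
      where "x = (int (i + 1), int (\<pi> ! i))" "y = (int (j + 1), int (\<pi> ! j))" "i < length \<pi>" "j < length \<pi>" "h i = h j"
      by (auto simp: diagram_def idx)
    then show "x = y" using hm[of i j] hm[of j i] by (cases i j rule: linorder_cases) auto
  qed
  then have "bij_betw ?f (diagram \<pi>) ?T" by (rule inj_on_imp_bij_betw)
  moreover have "\<forall>p\<in>diagram \<pi>. \<forall>q\<in>diagram \<pi>. (fst p < fst q) = (fst (?f p) < fst (?f q)) \<and>
      (snd p < snd q) = (snd (?f p) < snd (?f q))"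
    using \<tau>(2) h(1) hm_int len by (auto simp: diagram_def order_iso_list_def idx)
  ultimately have "order_iso_pts (diagram \<pi>) ?T" unfolding order_iso_pts_def by blast
  moreover have "?T \<subseteq> diagram \<sigma>" using h(1) len by (auto simp: diagram_def)
  ultimately show "\<exists>T\<subseteq>diagram \<sigma>. order_iso_pts T (diagram \<pi>)" using order_iso_pts_sym by blast
next
  assume "\<exists>T\<subseteq>diagram \<sigma>. order_iso_pts T (diagram \<pi>)"
  then obtain T where T: "T \<subseteq> diagram \<sigma>" "order_iso_pts (diagram \<pi>) T"
    using order_iso_pts_sym by blast
  then obtain g where g: "bij_betw g (diagram \<pi>) T"
    and o: "\<And>p q. p\<in>diagram \<pi> \<Longrightarrow> q\<in>diagram \<pi> \<Longrightarrow> (fst p < fst q) = (fst (g p) < fst (g q)) \<and>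
        (snd p < snd q) = (snd (g p) < snd (g q))"
    unfolding order_iso_pts_def by blast
  let ?pt = "\<lambda>i. (int (i + 1), int (\<pi> ! i))"
  have "\<exists>k<length \<sigma>. g (?pt i) = (int (k + 1), int (\<sigma> ! k))" if "i < length \<pi>" for i
  proof -
    have "?pt i \<in> diagram \<pi>" using that by (auto simp: diagram_def)
    then have "g (?pt i) \<in> diagram \<sigma>" using g T(1) by (auto simp: bij_betw_def)
    then show ?thesis by (auto simp: diagram_def)
  qed
  then obtain h
    where h: "\<And>i. i < length \<pi> \<Longrightarrow> h i < length \<sigma> \<and> g (?pt i) = (int (h i + 1), int (\<sigma> ! h i))"
      by metis
  have hm: "(i < j \<longleftrightarrow> h i < h j) \<and> (\<pi> ! i < \<pi> ! j \<longleftrightarrow> \<sigma> ! h i < \<sigma> ! h j)"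
    if "i < length \<pi>" "j < length \<pi>" for i j
    using o[of "?pt i" "?pt j"] h[OF that(1)] h[OF that(2)] that by (auto simp: diagram_def)
  let ?\<tau> = "map (\<lambda>i. \<sigma> ! h i) [0..<length \<pi>]"
  have "subseq ?\<tau> \<sigma>" unfolding subseq_iff_index_map
  proof (intro exI[of _ h] conjI allI impI)
    fix i j assume "i < j \<and> j < length ?\<tau>"
    then show "h i < h j" using hm[of i j] by simp
  qed (use h in auto)
  moreover have "order_iso_list \<pi> ?\<tau>" using hm by (auto simp: order_iso_list_def)
  ultimately show "contains \<pi> \<sigma>" unfolding contains_def by blast
qed

lemma contains_iff_pts_iso:
  assumes "order_iso_pts S (diagram \<sigma>)"
  shows "contains \<pi> \<sigma> \<longleftrightarrow> (\<exists>T\<subseteq>S. order_iso_pts T (diagram \<pi>))"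
  unfolding contains_iff_pts
proof
  assume "\<exists>T\<subseteq>diagram \<sigma>. order_iso_pts T (diagram \<pi>)"
  then obtain T where T: "T \<subseteq> diagram \<sigma>" "order_iso_pts T (diagram \<pi>)" by blast
  obtain T' where "T' \<subseteq> S" "order_iso_pts T T'"
    using order_iso_pts_subset[OF order_iso_pts_sym[OF assms] T(1)] by blast
  then show "\<exists>T\<subseteq>S. order_iso_pts T (diagram \<pi>)"
    using order_iso_pts_trans[OF order_iso_pts_sym T(2)] by blast
next
  assume "\<exists>T\<subseteq>S. order_iso_pts T (diagram \<pi>)"
  then obtain T where T: "T \<subseteq> S" "order_iso_pts T (diagram \<pi>)" by blast
  obtain T' where "T' \<subseteq> diagram \<sigma>" "order_iso_pts T T'"
    using order_iso_pts_subset[OF assms T(1)] by blast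
  then show "\<exists>T\<subseteq>diagram \<sigma>. order_iso_pts T (diagram \<pi>)"
    using order_iso_pts_trans[OF order_iso_pts_sym T(2)] by blast
qed

section \<open>Intervals and simple permutations\<close>

lemma rank_bij_betw:
  fixes f :: "'a \<Rightarrow> int"
  assumes "finite S" "inj_on f S"
  defines "rk \<equiv> \<lambda>x. card {y \<in> S. f y \<le> f x}"
  shows "bij_betw rk S {1..card S}"
    and "\<And>x y. x \<in> S \<Longrightarrow> y \<in> S \<Longrightarrow> rk x < rk y \<longleftrightarrow> f x < f y"
proof -
  have lt: "rk x < rk y" if "x \<in> S" "y \<in> S" "f x < f y" for x y
    unfolding rk_def
  proof (rule psubset_card_mono)
    show "{z \<in> S. f z \<le> f x} \<subset> {z \<in> S. f z \<le> f y}" using that(2,3)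
      by (intro psubsetI) (auto dest!: equalityD2 subsetD[of _ _ y])
  qed (use assms(1) in simp)
  show lt_iff: "rk x < rk y \<longleftrightarrow> f x < f y" if "x \<in> S" "y \<in> S" for x y
    using lt[OF that] lt[OF that(2,1)] assms(2) that
    by (cases "f x" "f y" rule: linorder_cases) (auto simp: inj_on_def)
  have inj: "inj_on rk S"
  proof (rule inj_onI)
    fix x y assume "x \<in> S" "y \<in> S" "rk x = rk y"
    then have "f x = f y" using lt[of x y] lt[of y x]
      by (cases "f x" "f y" rule: linorder_cases) auto
    then show "x = y" using assms(2) \<open>x \<in> S\<close> \<open>y \<in> S\<close> by (auto simp: inj_on_def)
  qed
  have "rk ` S \<subseteq> {1..card S}"
  proof
    fix n assume "n \<in> rk ` S"
    then obtain x where x: "x \<in> S" "n = rk x" by blast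
    have "{x} \<subseteq> {y \<in> S. f y \<le> f x}" using x by auto
    from card_mono[OF _ this] card_mono[OF assms(1), of "{y \<in> S. f y \<le> f x}"] assms(1) x(2)
    show "n \<in> {1..card S}" unfolding rk_def by auto
  qed
  then show "bij_betw rk S {1..card S}"
    using inj card_subset_eq[of "{1..card S}" "rk ` S"] card_image[OF inj]
      by (auto simp: bij_betw_def)
qed

text \<open>Both coordinates are replaced by their ranks; distinct columns and rows make the rank
  maps bijective, and \<sigma> sends the rank of \<open>fst\<close> to the rank of
  \<open>snd\<close>.\<close>

lemma ex_standardization:
  fixes S :: "pin set"
  assumes "finite S" "inj_on fst S" "inj_on snd S"
  shows "\<exists>\<sigma>. is_perm \<sigma> \<and> length \<sigma> = card S \<and> order_iso_pts S (diagram \<sigma>)"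
proof -
  define rx where "rx = (\<lambda>x :: pin. card {y \<in> S. fst y \<le> fst x})"
  define ry where "ry = (\<lambda>x :: pin. card {y \<in> S. snd y \<le> snd x})"
  have x: "bij_betw rx S {1..card S}" "\<And>x y. x \<in> S \<Longrightarrow> y \<in> S \<Longrightarrow> rx x < rx y \<longleftrightarrow> fst x < fst y"
    using rank_bij_betw[OF assms(1,2)] unfolding rx_def by blast+
  have y: "bij_betw ry S {1..card S}" "\<And>x y. x \<in> S \<Longrightarrow> y \<in> S \<Longrightarrow> ry x < ry y \<longleftrightarrow> snd x < snd y"
    using rank_bij_betw[OF assms(1,3)] unfolding ry_def by blast+
  let ?g = "inv_into S rx"
  have g: "bij_betw ?g {1..card S} S" using x(1) by (rule bij_betw_inv_into)
  have rxg: "rx (?g k) = k" if "k \<in> {1..card S}" for k using bij_betw_inv_into_right[OF x(1) that] .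
  have grx: "?g (rx p) = p" if "p \<in> S" for p using bij_betw_inv_into_left[OF x(1) that] .
  define \<sigma> where "\<sigma> = map (\<lambda>i. ry (?g (Suc i))) [0..<card S]"
  have ran: "Suc ` {0..<card S} = {1..card S}"
    by (simp add: image_Suc_atLeastLessThan atLeastLessThanSuc_atLeastAtMost)
  have "set \<sigma> = ry ` ?g ` Suc ` {0..<card S}" by (simp only: \<sigma>_def set_map set_upt image_image)
  also have "\<dots> = {1..card S}" unfolding ran using g y(1) by (simp add: bij_betw_def)
  finally have "is_perm \<sigma>" by (simp add: is_perm_def \<sigma>_def)
  let ?f = "\<lambda>p. (int (rx p), int (ry p))"
  have "?f ` S = diagram \<sigma>"
  proof
    show "?f ` S \<subseteq> diagram \<sigma>"
    proof
      fix z assume "z \<in> ?f ` S"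
      then obtain p where p: "p \<in> S" "z = ?f p" by blast
      have "rx p \<in> {1..card S}" using x(1) p(1) by (auto simp: bij_betw_def)
      then obtain i where "rx p = Suc i" "i < card S" by (cases "rx p") auto
      then show "z \<in> diagram \<sigma>" using grx[OF p(1)] p(2) by (auto simp: diagram_def \<sigma>_def)
    qed
    show "diagram \<sigma> \<subseteq> ?f ` S"
    proof
      fix z assume "z \<in> diagram \<sigma>"
      then obtain i where i: "i < card S" "z = (int (i + 1), int (ry (?g (Suc i))))"
        by (auto simp: diagram_def \<sigma>_def)
      have "Suc i \<in> {1..card S}" using i(1) by auto
      then have "?g (Suc i) \<in> S" "rx (?g (Suc i)) = Suc i" using g rxg by (auto simp: bij_betw_def)
      then show "z \<in> ?f ` S" using i(2) by (auto simp: image_iff intro!: bexI[of _ "?g (Suc i)"])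
    qed
  qed
  moreover have "inj_on ?f S" using x(1) by (auto simp: bij_betw_def inj_on_def)
  ultimately have "order_iso_pts S (diagram \<sigma>)"
    unfolding order_iso_pts_def bij_betw_def using x(2) y(2) by (intro exI[of _ ?f]) auto
  then show ?thesis using \<open>is_perm \<sigma>\<close> by (intro exI[of _ \<sigma>]) (simp add: \<sigma>_def)
qed

lemma convex_nat_set_eq_interval:
  fixes I :: "nat set"
  assumes "finite I" "I \<noteq> {}" "\<And>a b c. a \<in> I \<Longrightarrow> b \<in> I \<Longrightarrow> a < c \<Longrightarrow> c < b \<Longrightarrow> c \<in> I"
  shows "\<exists>m. I = {m..<m + card I}"
proof -
  have "I = {Min I..<Suc (Max I)}"
  proof
    show "I \<subseteq> {Min I..<Suc (Max I)}" using assms(1) by (auto simp: less_Suc_eq_le)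
    show "{Min I..<Suc (Max I)} \<subseteq> I"
    proof
      fix c assume c: "c \<in> {Min I..<Suc (Max I)}"
      have "Min I \<in> I" "Max I \<in> I" using assms(1,2) by auto
      then show "c \<in> I" using assms(3)[of "Min I" "Max I" c] c
        by (cases "c = Min I"; cases "c = Max I") auto
    qed
  qed
  moreover have "Min I \<le> Max I" using assms(1,2) by auto
  ultimately have "I = {Min I..<Min I + card I}"
    using card_atLeastLessThan[of "Min I" "Suc (Max I)"] by (metis le_SucI le_add_diff_inverse)
  then show ?thesis by blast
qed

text \<open>The intervals of a permutation, expressed through order alone. Unlike blocks of
  consecutive positions, they pass through order isomorphisms and make sense for pins.\<close>

definition pt_interval :: "pin set \<Rightarrow> pin set \<Rightarrow> bool" where
  "pt_interval A T \<longleftrightarrow> A \<subseteq> T \<and> (\<forall>c\<in>T - A.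
     ((\<forall>p\<in>A. fst c < fst p) \<or> (\<forall>p\<in>A. fst p < fst c)) \<and>
     ((\<forall>p\<in>A. snd c < snd p) \<or> (\<forall>p\<in>A. snd p < snd c)))"

text \<open>An outside point whose position or value fell between two members of \<open>A\<close>
  would see \<open>A\<close> on both sides. Hence positions and values of \<open>A\<close> are
  consecutive; for values this uses that a permutation attains every number in between.\<close>

lemma simple_perm_no_pt_interval_diagram:
  assumes "simple_perm \<pi>" "pt_interval A (diagram \<pi>)" "2 \<le> card A"
  shows "A = diagram \<pi>"
proof (rule ccontr)
  assume ne: "A \<noteq> diagram \<pi>"
  let ?n = "length \<pi>" and ?pt = "\<lambda>i. (int (i + 1), int (\<pi> ! i))"
  have perm: "set \<pi> = {1..?n}" using assms(1) by (simp add: simple_perm_def is_perm_def)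
  have D: "diagram \<pi> = ?pt ` {..<?n}" by (auto simp: diagram_def)
  have "card (set \<pi>) = ?n" unfolding perm by simp
  then have dist: "distinct \<pi>" by (rule card_distinct)
  define I where "I = {i. i < ?n \<and> ?pt i \<in> A}"
  have finI: "finite I" by (simp add: I_def)
  have "A \<subseteq> ?pt ` {..<?n}" using assms(2) unfolding pt_interval_def D by blast
  then have A: "A = ?pt ` I" unfolding I_def by blast
  have injpt: "inj_on ?pt X" for X by (auto simp: inj_on_def)
  have cI: "card I = card A" unfolding A by (rule card_image[OF injpt, symmetric])
  have out: "((\<forall>i\<in>I. c < i) \<or> (\<forall>i\<in>I. i < c)) \<and> ((\<forall>i\<in>I. \<pi> ! c < \<pi> ! i) \<or> (\<forall>i\<in>I. \<pi> ! i < \<pi> ! c))"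
    if "c < ?n" "c \<notin> I" for c
  proof -
    have "?pt c \<in> diagram \<pi> - A" using that unfolding D I_def by blast
    then have "((\<forall>p\<in>A. fst (?pt c) < fst p) \<or> (\<forall>p\<in>A. fst p < fst (?pt c))) \<and>
     ((\<forall>p\<in>A. snd (?pt c) < snd p) \<or> (\<forall>p\<in>A. snd p < snd (?pt c)))"
      using assms(2) unfolding pt_interval_def by blast
    then show ?thesis unfolding A
      by (simp only: ball_simps fst_conv snd_conv of_nat_less_iff add_less_cancel_right)
  qed
  have Ilt: "i < ?n" if "i \<in> I" for i using that by (simp add: I_def)
  have Ine: "I \<noteq> {}" using cI assms(3) by auto
  have "\<exists>m. I = {m..<m + card I}"
  proof (rule convex_nat_set_eq_interval[OF finI Ine])
    fix a b c assume abc: "a \<in> I" "b \<in> I" "a < c" "c < b"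
    show "c \<in> I"
    proof (rule ccontr)
      assume "c \<notin> I"
      moreover have "c < ?n" using Ilt[OF abc(2)] abc(4) by simp
      ultimately have "(\<forall>i\<in>I. c < i) \<or> (\<forall>i\<in>I. i < c)" using out by blast
      then show False
        using bspec[OF _ abc(1), of "\<lambda>i. c < i"] bspec[OF _ abc(2), of "\<lambda>i. i < c"] abc(3,4)
          by linarith
    qed
  qed
  then obtain s where s: "I = {s..<s + card I}" by blast
  let ?V = "(\<lambda>i. \<pi> ! i) ` I"
  have cV: "card ?V = card I"
    by (rule card_image) (use Ilt dist in \<open>auto simp: inj_on_def nth_eq_iff_index_eq\<close>)
  have "\<exists>m. ?V = {m..<m + card ?V}"
  proof (rule convex_nat_set_eq_interval)
    fix a b c assume abc: "a \<in> ?V" "b \<in> ?V" "a < c" "c < b"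
    obtain i j where ij: "i \<in> I" "j \<in> I" "a = \<pi> ! i" "b = \<pi> ! j" using abc(1,2) by blast
    have "a \<in> set \<pi>" "b \<in> set \<pi>" using ij Ilt by auto
    then have "c \<in> set \<pi>" using abc(3,4) unfolding perm by auto
    then obtain k where k: "k < ?n" "c = \<pi> ! k" by (auto simp: in_set_conv_nth)
    show "c \<in> ?V"
    proof (rule ccontr)
      assume "c \<notin> ?V"
      then have "k \<notin> I" using k by blast
      then have "(\<forall>i\<in>I. \<pi> ! k < \<pi> ! i) \<or> (\<forall>i\<in>I. \<pi> ! i < \<pi> ! k)" using out[OF k(1)] by blast
      then show False
        using bspec[OF _ ij(1), of "\<lambda>i. \<pi> ! k < \<pi> ! i"] bspec[OF _ ij(2), of "\<lambda>i. \<pi> ! i < \<pi> ! k"] ij(3,4) k(2) abc(3,4)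
        by linarith
    qed
  qed (use finI Ine in auto)
  then obtain m where m: "?V = {m..<m + card I}" unfolding cV by blast
  have sub: "s + card I \<le> ?n"
  proof -
    have "0 < card I" using finI Ine by (simp add: card_gt_0_iff)
    then have "s + card I - 1 \<in> {s..<s + card I}" by auto
    then have "s + card I - 1 < ?n" using Ilt s by blast
    then show ?thesis by linarith
  qed
  have "set (take (card I) (drop s \<pi>)) = ?V"
  proof -
    have "set (take (card I) (drop s \<pi>)) = (\<lambda>i. \<pi> ! i) ` {s..<s + card I}"
    proof -
      have "take (card I) (drop s \<pi>) = map (\<lambda>i. \<pi> ! i) [s..<s + card I]"
        using sub by (intro nth_equalityI) auto
      then show ?thesis by simp
    qed
    then show ?thesis unfolding s[symmetric] .
  qed
  moreover have "card I \<le> ?n - 1"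
  proof -
    have "I \<noteq> {..<?n}" using ne A D by metis
    then have "I \<subset> {..<?n}" using Ilt by blast
    then have "card I < ?n" using psubset_card_mono[of "{..<?n}" I] by simp
    then show ?thesis by simp
  qed
  ultimately have "2 \<le> card I \<and> card I \<le> ?n - 1 \<and> s + card I \<le> ?n \<and>
      set (take (card I) (drop s \<pi>)) = {m..<m + card I}"
    using assms(3) cI sub m by (metis (no_types))
  then have "\<exists>i l m. 2 \<le> l \<and> l \<le> ?n - 1 \<and> i + l \<le> ?n \<and> set (take l (drop i \<pi>)) = {m..<m + l}"
    by (intro exI)
  then show False using assms(1) unfolding simple_perm_def by (elim conjE notE)
qed

lemma simple_perm_no_pt_interval:
  assumes "simple_perm \<pi>" "order_iso_pts T (diagram \<pi>)" "pt_interval A T" "2 \<le> card A"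
  shows "A = T"
proof -
  obtain f where f: "bij_betw f T (diagram \<pi>)"
    and o: "\<And>p q. p \<in> T \<Longrightarrow> q \<in> T \<Longrightarrow> (fst p < fst q) = (fst (f p) < fst (f q)) \<and>
        (snd p < snd q) = (snd (f p) < snd (f q))"
    using assms(2) unfolding order_iso_pts_def by blast
  have AT: "A \<subseteq> T" using assms(3) by (simp add: pt_interval_def)
  have inj: "inj_on f A" using f AT by (auto simp: bij_betw_def intro: inj_on_subset)
  have im: "f ` T = diagram \<pi>" using f by (simp add: bij_betw_def)
  have "pt_interval (f ` A) (diagram \<pi>)"
    unfolding pt_interval_def im[symmetric]
  proof (intro conjI ballI)
    show "f ` A \<subseteq> f ` T" using AT by blast
  next
    fix c assume "c \<in> f ` T - f ` A"
    then obtain x where x: "x \<in> T" "x \<notin> A" "c = f x" by blast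
    have "((\<forall>p\<in>A. fst x < fst p) \<or> (\<forall>p\<in>A. fst p < fst x)) \<and> ((\<forall>p\<in>A. snd x < snd p) \<or>
        (\<forall>p\<in>A. snd p < snd x))"
      using assms(3) x unfolding pt_interval_def by blast
    moreover have "(fst x < fst p) = (fst c < fst (f p)) \<and> (fst p < fst x) = (fst (f p) < fst c) \<and>
        (snd x < snd p) = (snd c < snd (f p)) \<and> (snd p < snd x) = (snd (f p) < snd c)" if "p \<in> A" for p
      using o[of x p] o[of p x] x AT that by auto
    ultimately show "(\<forall>p\<in>f ` A. fst c < fst p) \<or> (\<forall>p\<in>f ` A. fst p < fst c)"
      "(\<forall>p\<in>f ` A. snd c < snd p) \<or> (\<forall>p\<in>f ` A. snd p < snd c)" by auto
  qed
  moreover have "2 \<le> card (f ` A)" using card_image[OF inj] assms(4) by simp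
  ultimately have "f ` A = f ` T" using simple_perm_no_pt_interval_diagram[OF assms(1)] im by blast
  then show ?thesis using inj_on_image_eq_iff[of f T A T] f AT by (simp add: bij_betw_def)
qed

section \<open>Factors, alternation and the letters of a quadrant\<close>

lemma factor_iff_nth:
  "factor v w \<longleftrightarrow> (\<exists>s. s + length v \<le> length w \<and> (\<forall>t<length v. v ! t = w ! (s + t)))"
proof
  assume "factor v w"
  then obtain a b where "w = a @ v @ b" by (auto simp: factor_def)
  then show "\<exists>s. s + length v \<le> length w \<and> (\<forall>t<length v. v ! t = w ! (s + t))"
    by (intro exI[of _ "length a"]) (auto simp: nth_append)
next
  assume "\<exists>s. s + length v \<le> length w \<and> (\<forall>t<length v. v ! t = w ! (s + t))"
  then obtain s where s: "s + length v \<le> length w" "\<forall>t<length v. v ! t = w ! (s + t)" by blast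
  have eq: "take (length v) (drop s w) = v" using s by (intro nth_equalityI) auto
  have "w = take s w @ take (length v) (drop s w) @ drop (length v) (drop s w)"
    by (simp only: append_take_drop_id)
  then have "w = take s w @ v @ drop (length v) (drop s w)" unfolding eq .
  then show "factor v w" unfolding factor_def by blast
qed

lemma vphi_quadrant:
  "a \<in> numerals \<Longrightarrow> b \<in> directions \<Longrightarrow> \<exists>c d. vphi a b = [c, d, b] \<and> quadrant_of a c d"
  unfolding numerals_def directions_def by (elim insertE emptyE; simp add: quadrant_of_cases)

text \<open>Of the two orders in which a quadrant can be spelled, \<open>vphi\<close> keeps the one
  whose second letter is perpendicular to the next direction.\<close>

lemma quadrant_of_vphi:
  "quadrant_of a c d \<Longrightarrow> b \<in> directions \<Longrightarrow> horiz d \<longleftrightarrow> vert b \<Longrightarrow> vphi a b = [c, d, b]"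
  unfolding directions_def quadrant_of_cases by (elim insertE emptyE; simp add: horiz_def vert_def)

lemma ex_quadrant_of:
  assumes "c \<in> directions" "d \<in> directions" "horiz c \<longleftrightarrow> vert d"
  shows "\<exists>a. quadrant_of a c d"
proof -
  have "quadrant_of N1 c d \<or> quadrant_of N2 c d \<or> quadrant_of N3 c d \<or> quadrant_of N4 c d"
    using assms unfolding directions_def quadrant_of_cases
    by (elim insertE emptyE; simp add: horiz_def vert_def)
  then show ?thesis by blast
qed

lemma alternating_iff_no_factor:
  assumes "set w \<subseteq> directions"
  shows "alternating w \<longleftrightarrow> (\<forall>v\<in>{[L,L],[L,R],[R,R],[R,L],[U,U],[U,D],[D,D],[D,U]}. \<not> factor v w)"
proof -
  have *: "factor [x, y] w \<longleftrightarrow> (\<exists>s. s + 1 < length w \<and> w ! s = x \<and> w ! (s + 1) = y)" for x y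
  proof -
    have "(\<forall>t<length [x, y]. [x, y] ! t = w ! (s + t)) \<longleftrightarrow> w ! s = x \<and> w ! (s + 1) = y" for s
      by (auto simp: less_Suc_eq numeral_2_eq_2)
    moreover have "s + length [x, y] \<le> length w \<longleftrightarrow> s + 1 < length w" for s by auto
    ultimately show ?thesis unfolding factor_iff_nth by blast
  qed
  define Q where "Q = {(L,L),(L,R),(R,R),(R,L),(U,U),(U,D),(D,D),(D,U)}"
  have "(horiz x \<longleftrightarrow> vert y) \<longleftrightarrow> (x, y) \<notin> Q" if "x \<in> directions" "y \<in> directions" for x y
    using that by (auto simp: directions_def horiz_def vert_def Q_def)
  moreover have "w ! s \<in> directions" if "s < length w" for s using assms that by auto
  ultimately have e: "(horiz (w ! s) \<longleftrightarrow> vert (w ! (s + 1))) \<longleftrightarrow> (w ! s, w ! (s + 1)) \<notin> Q"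
    if "s + 1 < length w" for s
    using that by simp
  have "alternating w \<longleftrightarrow> (\<forall>s. s + 1 < length w \<longrightarrow> (w ! s, w ! (s + 1)) \<notin> Q)"
    unfolding alternating_def using assms e by blast
  also have "\<dots> \<longleftrightarrow> (\<forall>(x, y)\<in>Q. \<not> factor [x, y] w)"
    unfolding * by blast
  also have "\<dots> \<longleftrightarrow> (\<forall>v\<in>{[L,L],[L,R],[R,R],[R,L],[U,U],[U,D],[D,D],[D,U]}. \<not> factor v w)"
    by (simp add: Q_def)
  finally show ?thesis .
qed

section \<open>From factors to patterns\<close>

lemma pin_chain_cong:
  assumes "pin_chain a d p n" "\<And>k. 2 \<le> k \<Longrightarrow> k \<le> n \<Longrightarrow> d k = d' k"
  shows "pin_chain a d' p n"
  using assms unfolding pin_chain_def by metis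

text \<open>Properness sets in at index 2, exactly where a chain begins to carry letters; pins 0 and
  1 only need a quadrant, which distinct rows and columns provide.\<close>

lemma pin_chain_of_proper_pin_seq:
  assumes "proper_pin_seq ps" "2 \<le> length ps"
  shows "\<exists>a d. pin_chain a d (\<lambda>k. ps ! k) (length ps - 1)"
proof -
  let ?p = "\<lambda>k. ps ! k"
  have seq: "pin_seq ps" using assms(1) by (simp add: proper_pin_seq_def)
  have "\<exists>d. pin_in_dir d (?p ` {..<k - 1}) (?p (k - 1)) (?p k)" if k: "2 \<le> k" "k < length ps" for k
  proof (rule ex_pin_in_dir)
    have t: "set (take j ps) = ?p ` {..<j}" if "j \<le> length ps" for j
      using nth_image[OF that] by (simp add: atLeast0LessThan)
    have "{..<k} = insert (k - 1) {..<k - 1}" using k(1) by auto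
    then have tk: "set (take k ps) = insert (?p (k - 1)) (?p ` {..<k - 1})" using t[of k] k(2)
      by simp
    show "separates (?p k) {?p (k - 1)} (?p ` {..<k - 1})"
    proof -
      have "k - 1 \<le> length ps" using k(2) by simp
      from t[OF this] show ?thesis using assms(1) k unfolding proper_pin_seq_def by metis
    qed
    have "\<not> in_bbox (ps ! k) (set (take k ps))" using seq k by (simp add: pin_seq_def)
    then show "\<not> in_bbox (?p k) (insert (?p (k - 1)) (?p ` {..<k - 1}))" unfolding tk .
    have "0 \<in> {..<k - 1}" using k(1) by simp
    then show "?p ` {..<k - 1} \<noteq> {}" by blast
  qed simp
  then obtain d
    where d: "\<And>k. 2 \<le> k \<Longrightarrow> k < length ps \<Longrightarrow> pin_in_dir (d k) (?p ` {..<k - 1}) (?p (k - 1)) (?p k)"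
    by metis
  have "0 < length ps" "1 < length ps" using assms(2) by auto
  then have "fst (ps ! 0) \<noteq> fst (ps ! 1)" "snd (ps ! 0) \<noteq> snd (ps ! 1)"
    using seq unfolding pin_seq_def by (metis zero_neq_one)+
  then obtain a where "in_quadrant a {ps ! 0} (ps ! 1)" using ex_in_quadrant by blast
  then show ?thesis using d assms(2) by (intro exI[of _ a] exI[of _ d]) (auto simp: pin_chain_def)
qed

text \<open>The origin of the pin word becomes pin 0 of the chain, hence the shift in
  \<open>u ! (k - 1)\<close> and the omission of index 0 from the pattern.\<close>

lemma pin_chain_of_strict_pin_word:
  assumes "strict_pw u" "pin_word_of u \<pi>"
  shows "\<exists>r. pin_chain (hd u) (\<lambda>k. u ! (k - 1)) r (length u) \<and>
      order_iso_pts (r ` {1..length u}) (diagram \<pi>)"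
proof -
  obtain p where p: "pin_rep (map (\<lambda>k. p (Suc k)) [0..<length u]) \<pi>"
    and q: "\<And>k. k < length u \<Longrightarrow> u ! k \<in> numerals \<Longrightarrow> in_quadrant (u ! k) (p ` {..<Suc k}) (p (Suc k))"
    and d: "\<And>k. 1 \<le> k \<Longrightarrow> k < length u \<Longrightarrow> u ! k \<in> directions \<Longrightarrow>
        pin_in_dir (u ! k) (p ` {..<k}) (p k) (p (Suc k))"
    using pin_word_of_link[OF assms(2)] by blast
  have len: "2 \<le> length u" using assms(1) by (simp add: strict_pw_def)
  then have hd: "u ! 0 = hd u" by (intro hd_conv_nth[symmetric]) auto
  have dirs: "u ! k \<in> directions" if "1 \<le> k" "k < length u" for k
  proof -
    have "u ! k = tl u ! (k - 1)" using that by (simp add: nth_tl)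
    moreover have "tl u ! (k - 1) \<in> set (tl u)" using that by (intro nth_mem) simp
    ultimately show ?thesis using assms(1) by (auto simp: strict_pw_def)
  qed
  have "pin_chain (hd u) (\<lambda>k. u ! (k - 1)) p (length u)"
    unfolding pin_chain_def
  proof (intro conjI allI impI)
    have "u ! 0 \<in> numerals" "0 < length u" using assms(1) hd len by (auto simp: strict_pw_def)
    from q[OF this(2,1)] show "in_quadrant (hd u) {p 0} (p 1)" by (simp add: hd lessThan_Suc)
  next
    fix k assume k: "2 \<le> k \<and> k \<le> length u"
    then have k': "Suc (k - 1) = k" "1 \<le> k - 1" "k - 1 < length u" by auto
    from d[OF k'(2,3) dirs[OF k'(2,3)]]
    show "pin_in_dir (u ! (k - 1)) (p ` {..<k - 1}) (p (k - 1)) (p k)" unfolding k'(1) .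
  qed
  moreover have "{1..length u} = Suc ` {0..<length u}"
    by (simp add: image_Suc_atLeastLessThan atLeastLessThanSuc_atLeastAtMost)
  then have "order_iso_pts (p ` {1..length u}) (diagram \<pi>)"
    using p unfolding pin_rep_def by (simp only: image_image set_map set_upt)
  ultimately show ?thesis by blast
qed

text \<open>Here the origin is discarded and the first pin takes its place. The second numeral,
  valid for both of them, remains valid for that pin alone, and index 0 now belongs to the
  pattern.\<close>

lemma pin_chain_of_quasi_strict_pin_word:
  assumes "quasi_strict_pw u" "pin_word_of u \<pi>"
  shows "\<exists>r. pin_chain (u ! 1) (\<lambda>k. u ! k) r (length u - 1) \<and>
      order_iso_pts (r ` {..length u - 1}) (diagram \<pi>)"
proof -
  obtain p where p: "pin_rep (map (\<lambda>k. p (Suc k)) [0..<length u]) \<pi>"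
    and q: "\<And>k. k < length u \<Longrightarrow> u ! k \<in> numerals \<Longrightarrow> in_quadrant (u ! k) (p ` {..<Suc k}) (p (Suc k))"
    and d: "\<And>k. 1 \<le> k \<Longrightarrow> k < length u \<Longrightarrow> u ! k \<in> directions \<Longrightarrow>
        pin_in_dir (u ! k) (p ` {..<k}) (p k) (p (Suc k))"
    using pin_word_of_link[OF assms(2)] by blast
  have len: "2 \<le> length u" and num: "u ! 1 \<in> numerals" using assms(1)
    by (auto simp: quasi_strict_pw_def)
  have dirs: "u ! k \<in> directions" if "2 \<le> k" "k < length u" for k
  proof -
    have "u ! k = drop 2 u ! (k - 2)" using that by (simp del: add_2_eq_Suc)
    moreover have "drop 2 u ! (k - 2) \<in> set (drop 2 u)" using that by (intro nth_mem) simp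
    ultimately show ?thesis using assms(1) by (auto simp: quasi_strict_pw_def)
  qed
  let ?r = "\<lambda>k. p (Suc k)"
  have "pin_chain (u ! 1) (\<lambda>k. u ! k) ?r (length u - 1)"
    unfolding pin_chain_def
  proof (intro conjI allI impI)
    have "1 < length u" using len by simp
    from q[OF this num] show "in_quadrant (u ! 1) {p (Suc 0)} (p (Suc 1))"
      by (rule in_quadrant_mono) auto
  next
    fix k assume k: "2 \<le> k \<and> k \<le> length u - 1"
    then have k': "Suc (k - 1) = k" "1 \<le> k" "2 \<le> k" "k < length u" by auto
    from d[OF k'(2,4) dirs[OF k'(3,4)]]
    show "pin_in_dir (u ! k) (?r ` {..<k - 1}) (p (Suc (k - 1))) (p (Suc k))"
      unfolding k'(1) by (rule pin_in_dir_mono) auto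
  qed
  moreover have "{0..<length u} = {..length u - 1}" using len by auto
  then have "order_iso_pts (?r ` {..length u - 1}) (diagram \<pi>)"
    using p unfolding pin_rep_def by (simp only: set_map set_upt)
  ultimately show ?thesis by (intro exI[of _ ?r]) simp
qed

lemma phi_Cons_elim:
  assumes "y \<in> phi (b # ds)" "b \<in> numerals" "set ds \<subseteq> directions"
  shows "\<exists>c1 c2. quadrant_of b c1 c2 \<and> y = c1 # c2 # ds"
proof (cases ds)
  case Nil
  have "\<exists>c1 c2. y = [c1, c2]" using assms(1,2) Nil by (auto simp: numerals_def)
  then show ?thesis using assms(1) Nil by (auto simp: quadrant_of_def)
next
  case (Cons e es)
  then have "y = vphi b e @ es" using assms(1) by (cases b) auto
  then show ?thesis using vphi_quadrant[OF assms(2), of e] assms(3) Cons by auto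
qed

text \<open>Alternation selects the spelling that \<open>vphi\<close> has kept; after a lone numeral
  both spellings are in \<open>phi\<close>.\<close>

lemma phi_Cons_intro:
  assumes "quadrant_of b c1 c2" "alternating (c2 # ds)"
  shows "c1 # c2 # ds \<in> phi (b # ds)"
proof (cases ds)
  case Nil
  with assms(1) show ?thesis by (simp add: quadrant_of_def)
next
  case (Cons e es)
  have "e \<in> directions" "horiz c2 \<longleftrightarrow> vert e"
    using assms(2) Cons by (auto simp: alternating_def dest!: spec[of _ 0])
  then show ?thesis using quadrant_of_vphi[OF assms(1)] Cons by (cases b) auto
qed

text \<open>A run with the same numeral and letters as the model chain \<open>r\<close> has its
  order type, so the pattern moves into \<sigma>. The set \<open>K\<close> decides whether pin 0 is
  part of the pattern or only its origin.\<close>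

lemma contains_of_subchain:
  assumes "pin_chain a d p n" "order_iso_pts (p ` {..n}) (diagram \<sigma>)"
    and "3 \<le> i" "h + 2 \<le> i" "i + m \<le> n + 1" "1 \<le> m" "quadrant_of b (d (i - 1)) (d i)"
    and "pin_chain b e r m" "\<And>k. 2 \<le> k \<Longrightarrow> k \<le> m \<Longrightarrow> d (i + k - 1) = e k"
    and "K \<subseteq> {..m}" "order_iso_pts (r ` K) (diagram \<pi>)"
  shows "contains \<pi> \<sigma>"
proof -
  let ?q = "\<lambda>k. if k = 0 then p h else p (i + k - 1)"
  have "pin_chain b e ?q m"
    by (rule pin_chain_cong[OF pin_chain_subchain[OF assms(1,3-7)] assms(9)])
  from order_iso_pts_trans[OF order_iso_pts_pin_chain[OF this assms(8,10)] assms(11)]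
  have "order_iso_pts (?q ` K) (diagram \<pi>)" .
  moreover have "?q ` K \<subseteq> p ` {..n}"
  proof (intro image_subsetI)
    fix k assume "k \<in> K"
    then have "k \<le> m" using assms(10) by auto
    then show "?q k \<in> p ` {..n}" using assms(3-5) by auto
  qed
  ultimately show ?thesis using contains_iff_pts_iso[OF assms(2)] by blast
qed

text \<open>Letter \<open>t\<close> of \<open>v\<close> belongs to pin \<open>s + 2 + t\<close>. Two
  letters spell the numeral and the run starts at the pin of the second: \<open>s + 3\<close> for
  strict words, \<open>s + 5\<close> behind a prefix of two letters.\<close>

lemma contains_of_E_factor:
  assumes "pin_chain a d p n" "order_iso_pts (p ` {..n}) (diagram \<sigma>)"
    and "v \<in> E \<pi>" "s + length v + 1 \<le> n" "\<And>t. t < length v \<Longrightarrow> v ! t = d (s + 2 + t)"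
  shows "contains \<pi> \<sigma>"
  using assms(3) unfolding E_def
proof (elim UnE CollectE exE conjE)
  fix u assume u: "strict_pw u" "pin_word_of u \<pi>" "v \<in> phi u"
  obtain b ds where bds: "u = b # ds" "b \<in> numerals" "set ds \<subseteq> directions"
    using u(1) by (cases u) (auto simp: strict_pw_def)
  obtain c1 c2 where c: "quadrant_of b c1 c2" "v = c1 # c2 # ds" using phi_Cons_elim u(3) bds
    by blast
  obtain r where r: "pin_chain b (\<lambda>k. u ! (k - 1)) r (length u)" "order_iso_pts (r ` {1..length u}) (diagram \<pi>)"
    using pin_chain_of_strict_pin_word[OF u(1,2)] bds(1) by auto
  have lens: "length v = length u + 1" using c bds by simp
  show ?thesis
  proof (rule contains_of_subchain[OF assms(1,2) _ _ _ _ _ r(1) _ _ r(2)])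
    \<comment> \<open>The origin is pin \<open>s + 1\<close>, the newest one two steps before the
      run; it stays outside the pattern.\<close>
    show "3 \<le> s + 3" "s + 1 + 2 \<le> s + 3" "s + 3 + length u \<le> n + 1" "1 \<le> length u" "{1..length u} \<subseteq> {..length u}"
      using assms(4) lens bds(1) by auto
    have "d (s + 2) = c1" "d (s + 3) = c2"
      using assms(5)[of 0] assms(5)[of 1] c(2) by (auto simp: numeral_3_eq_3)
    then show "quadrant_of b (d (s + 3 - 1)) (d (s + 3))" using c(1) by simp
    fix k assume k: "2 \<le> k" "k \<le> length u"
    have "d (s + 3 + k - 1) = v ! k" using assms(5)[of k] k lens
      by (simp add: add.assoc numeral_eq_Suc)
    also have "\<dots> = u ! (k - 1)"
      using k c(2) bds(1) by (cases k; cases "k - 1") auto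
    finally show "d (s + 3 + k - 1) = u ! (k - 1)" .
  qed
next
  fix u x y assume u: "quasi_strict_pw u" "pin_word_of u \<pi>" "x \<in> Xpre" "y \<in> phi (tl u)" "v = x @ y"
  obtain b0 b ds where bds: "u = b0 # b # ds" "b \<in> numerals" "set ds \<subseteq> directions"
    using u(1) by (cases u; cases "tl u") (auto simp: quasi_strict_pw_def)
  obtain c1 c2 where c: "quadrant_of b c1 c2" "y = c1 # c2 # ds"
    using phi_Cons_elim[of y b ds] u(4) bds by auto
  obtain r where r: "pin_chain b (\<lambda>k. u ! k) r (length u - 1)" "order_iso_pts (r ` {..length u - 1}) (diagram \<pi>)"
    using pin_chain_of_quasi_strict_pin_word[OF u(1,2)] bds(1) by auto
  have x: "length x = 2" using u(3) by (auto simp: Xpre_def)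
  have lens: "length v = length u + 2" using c(2) bds u(5) x by simp
  have v: "v ! (2 + k) = y ! k" for k using u(5) x by (metis nth_append_length_plus)
  show ?thesis
  proof (rule contains_of_subchain[OF assms(1,2) _ _ _ _ _ r(1) _ _ r(2)])
    \<comment> \<open>Pin \<open>s + 3\<close>, which carries the second letter of \<open>x\<close>,
      is the first point of the pattern.\<close>
    show "3 \<le> s + 5" "s + 3 + 2 \<le> s + 5" "s + 5 + (length u - 1) \<le> n + 1" "1 \<le> length u - 1" "{..length u - 1} \<subseteq> {..length u - 1}"
      using assms(4) lens bds(1) by auto
    have "d (s + 4) = c1" "d (s + 5) = c2"
      using assms(5)[of "2 + 0"] assms(5)[of "2 + 1"] c(2) lens bds(1) unfolding v
        by (auto simp: numeral_eq_Suc)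
    moreover have "s + 5 - 1 = s + 4" by simp
    ultimately show "quadrant_of b (d (s + 5 - 1)) (d (s + 5))" using c(1) by (simp only:)
    fix k assume k: "2 \<le> k" "k \<le> length u - 1"
    have "d (s + 5 + k - 1) = v ! (2 + k)" using assms(5)[of "2 + k"] k lens
      by (simp add: add.assoc numeral_eq_Suc)
    also have "\<dots> = u ! k" unfolding v using k c(2) bds(1) by (cases k; cases "k - 1") auto
    finally show "d (s + 5 + k - 1) = u ! k" .
  qed
qed

section \<open>From patterns to factors\<close>

lemma card_diagram: "card (diagram \<pi>) = length \<pi>"
proof -
  have "diagram \<pi> = (\<lambda>i. (int (i + 1), int (\<pi> ! i))) ` {..<length \<pi>}" by (auto simp: diagram_def)
  moreover have "inj_on (\<lambda>i. (int (i + 1), int (\<pi> ! i))) {..<length \<pi>}" by (auto simp: inj_on_def)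
  ultimately show ?thesis by (simp add: card_image)
qed

lemma pin_chain_inj_on:
  assumes "pin_chain a d p n"
  shows "inj_on p {..n}" "inj_on fst (p ` {..n})" "inj_on snd (p ` {..n})"
proof -
  have eq: "k = l" if "k \<in> {..n}" "l \<in> {..n}" "fst (p k) = fst (p l) \<or> snd (p k) = snd (p l)"
    for k l
    using pin_chain_coords_neq[OF assms, of k l] that by auto
  show "inj_on p {..n}" "inj_on fst (p ` {..n})" "inj_on snd (p ` {..n})"
    unfolding inj_on_def using eq by (metis, (blast dest: eq)+)
qed

text \<open>Only \<open>l\<close> is cut off, so neither line through \<open>q\<close> splits
  \<open>S\<close>. This is why the pins chosen before a gap form an interval.\<close>

lemma pin_in_dir_outside:
  assumes "pin_in_dir d S l q"
  shows "((\<forall>p\<in>S. fst q < fst p) \<or> (\<forall>p\<in>S. fst p < fst q)) \<and>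
     ((\<forall>p\<in>S. snd q < snd p) \<or> (\<forall>p\<in>S. snd p < snd q))"
  using assms unfolding pin_in_dir_def sep_h_def sep_v_def by (cases d) auto

lemma alternating_map_nth:
  assumes "alternating w" "e \<le> length w"
  shows "alternating (map (\<lambda>k. w ! k) [s..<e])"
  unfolding alternating_def
proof (intro conjI allI impI)
  show "set (map (\<lambda>k. w ! k) [s..<e]) \<subseteq> directions"
    using assms by (auto simp: alternating_def dest!: nth_mem)
next
  fix i assume i: "i + 1 < length (map (\<lambda>k. w ! k) [s..<e])"
  then have "s + i + 1 < length w" using assms(2) by auto
  then have "horiz (w ! (s + i)) = vert (w ! (s + i + 1))" using assms(1)
    by (simp add: alternating_def)
  then show "horiz (map (\<lambda>k. w ! k) [s..<e] ! i) = vert (map (\<lambda>k. w ! k) [s..<e] ! (i + 1))"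
    using i by simp
qed

lemma factor_map_nth: "s \<le> e \<Longrightarrow> e \<le> length w \<Longrightarrow> factor (map (\<lambda>k. w ! k) [s..<e]) w"
  unfolding factor_iff_nth by (intro exI[of _ s]) auto

lemma run_in_simple_pattern:
  fixes K :: "nat set"
  assumes chain: "pin_chain a d p n" and K: "K \<subseteq> {3..n}" "2 \<le> card K"
    and "simple_perm \<pi>" "order_iso_pts (p ` K) (diagram \<pi>)"
  obtains i j where "3 \<le> i" "i < j" "K = {i..j}"
  | h i j where "3 \<le> h" "h + 2 \<le> i" "i \<le> j" "K = insert h {i..j}"
proof -
  have fin: "finite K" using K(1) finite_subset by blast
  have "K \<noteq> {}" using K(2) by auto
  define j where "j = Max K"
  have j: "j \<in> K" "\<And>k. k \<in> K \<Longrightarrow> k \<le> j" using fin \<open>K \<noteq> {}\<close> by (auto simp: j_def)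
  define G where "G = {g. g \<le> j \<and> g \<notin> K}"
  \<comment> \<open>As \<open>K\<close> starts at 3, index 2 is always a gap. The run behind the
    last gap therefore begins at 3 or later, where the quadrant of its first pin can be read from
    two letters.\<close>
  have "2 \<in> G" using K(1) j(1) by (auto simp: G_def)
  moreover have finG: "finite G" by (simp add: G_def)
  moreover have "G \<noteq> {}" using \<open>2 \<in> G\<close> by blast
  ultimately have "Max G \<in> G" "2 \<le> Max G" "\<And>x. x \<in> G \<Longrightarrow> x \<le> Max G"
    using Max_in[OF finG] by auto
  then obtain g where g: "g \<in> G" "2 \<le> g" "\<And>x. x \<in> G \<Longrightarrow> x \<le> g" by blast
  have gj: "g < j" "g \<notin> K" using g(1) j(1) by (auto simp: G_def le_less)
  have run: "{g + 1..j} \<subseteq> K"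
  proof
    fix k assume "k \<in> {g + 1..j}"
    then show "k \<in> K" using g(3)[of k] by (auto simp: G_def)
  qed
  define A where "A = {k \<in> K. k < g}"
  have K_eq: "K = A \<union> {g + 1..j}"
  proof
    show "K \<subseteq> A \<union> {g + 1..j}"
    proof
      fix k assume k: "k \<in> K"
      then have "k \<noteq> g" "k \<le> j" using gj(2) j(2) by auto
      then show "k \<in> A \<union> {g + 1..j}" using k by (auto simp: A_def)
    qed
  qed (use run in \<open>auto simp: A_def\<close>)
  have An: "A \<subseteq> {..n}" "K \<subseteq> {..n}" using K(1) by (auto simp: A_def)
  have inj: "inj_on p K" using pin_chain_inj_on(1)[OF chain] An(2) inj_on_subset by blast
  have "card A < 2"
  proof (rule ccontr)
    assume "\<not> card A < 2"
    then have "2 \<le> card (p ` A)"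
      using card_image[OF inj_on_subset[OF inj, of A]] by (auto simp: A_def)
    moreover have "pt_interval (p ` A) (p ` K)"
      unfolding pt_interval_def
    proof (intro conjI ballI)
      show "p ` A \<subseteq> p ` K" by (auto simp: A_def)
    next
      fix c assume "c \<in> p ` K - p ` A"
      then obtain k where k: "k \<in> K" "k \<notin> A" "c = p k" by blast
      then have "k \<in> {g + 1..j}" using K_eq by blast
      then have gk: "g < k" by simp
      have k2: "2 \<le> k" "k \<le> n" using k(1) K(1) by auto
      \<comment> \<open>The predecessor \<open>k - 1\<close> is at least \<open>g\<close> and so
        outside \<open>A\<close>; all of \<open>A\<close> is on the side that pin \<open>k\<close>
        does not split.\<close>
      have "pin_in_dir (d k) (p ` A) (p (k - 1)) (p k)"
      proof (rule pin_in_dir_mono[OF pin_chainD[OF chain k2]])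
        have "A \<subseteq> {..<k - 1}" using gk by (auto simp: A_def)
        then show "p ` A \<subseteq> p ` {..<k - 1}" by blast
      qed
      from pin_in_dir_outside[OF this]
      show "(\<forall>p\<in>p ` A. fst c < fst p) \<or> (\<forall>p\<in>p ` A. fst p < fst c)"
        "(\<forall>p\<in>p ` A. snd c < snd p) \<or> (\<forall>p\<in>p ` A. snd p < snd c)" unfolding k(3) by blast+
    qed
    ultimately have "p ` A = p ` K" using simple_perm_no_pt_interval[OF assms(4,5)] by blast
    then have "A = K" using inj_on_image_eq_iff[OF inj, of A K] by (auto simp: A_def)
    then have "j \<in> A" using j(1) by blast
    then show False using gj(1) by (simp add: A_def)
  qed
  then consider "card A = 0" | "card A = 1" by linarith
  then show ?thesis
  proof cases
    case 1
    have "finite A" using fin by (simp add: A_def)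
    then have "A = {}" using 1 by simp
    then have Kr: "K = {g + 1..j}" using K_eq by blast
    then have "g + 1 < j" using K(2) by (cases "g + 1 < j") auto
    then show ?thesis using that(1)[of "g + 1" j] Kr g(2) by linarith
  next
    case 2
    then obtain h where h: "A = {h}" by (rule card_1_singletonE)
    then have "h \<in> A" by simp
    then have "3 \<le> h" "h < g" using K(1) by (auto simp: A_def)
    then show ?thesis using that(2)[of h "g + 1" j] K_eq h gj(1) by auto
  qed
qed

lemma in_Xpre:
  "c \<in> directions \<Longrightarrow> d \<in> directions \<Longrightarrow> horiz c \<longleftrightarrow> vert d \<Longrightarrow> [c, d] \<in> Xpre"
  unfolding directions_def by (elim insertE emptyE; simp add: horiz_def vert_def Xpre_def)

lemma E_factor_of_simple_pattern:
  assumes alt: "alternating w" and chain: "pin_chain a (\<lambda>k. w ! k) p (length w - 1)"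
    and K: "K \<subseteq> {3..length w - 1}" "2 \<le> card K"
    and simple: "simple_perm \<pi>" and iso: "order_iso_pts (p ` K) (diagram \<pi>)"
  shows "\<exists>v\<in>E \<pi>. factor v w"
proof (rule run_in_simple_pattern[OF chain K simple iso])
  fix i j assume i: "3 \<le> i" "i < j" and Kij: "K = {i..j}"
  note [simp del] = upt_Suc
  have "j \<in> {3..length w - 1}" using K(1) Kij i by auto
  then have jw: "j < length w" using i by auto
  have dirs: "w ! k \<in> directions" if "k < length w" for k using alt that
    by (auto simp: alternating_def)
  have hv: "horiz (w ! k) = vert (w ! (k + 1))" if "k + 1 < length w" for k using alt that
    by (auto simp: alternating_def)
  have "horiz (w ! (i - 1)) \<longleftrightarrow> vert (w ! i)" using hv[of "i - 1"] i jw by simp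
  then obtain b where b: "quadrant_of b (w ! (i - 1)) (w ! i)"
    using ex_quadrant_of[of "w ! (i - 1)" "w ! i"] dirs[of "i - 1"] dirs[of i] i jw by auto
  have bn: "b \<in> numerals" using b by (auto simp: quadrant_of_cases numerals_def)
  define m where "m = j + 1 - i"
  let ?ds = "map (\<lambda>k. w ! k) [i + 1..<j + 1]"
  \<comment> \<open>A strict word needs an origin outside the run; pin \<open>i - 2\<close> is the
    newest one that sees pin \<open>i\<close> in the quadrant spelled by letters
    \<open>i - 1\<close> and \<open>i\<close>.\<close>
  let ?r = "\<lambda>k. if k = 0 then p (i - 2) else p (i + k - 1)"
  let ?c = "\<lambda>k. if k = 1 then b else w ! (i + k - 1)"
  have sub: "pin_chain b (\<lambda>k. w ! (i + k - 1)) ?r m"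
    by (rule pin_chain_subchain[OF chain]) (use i jw b in \<open>auto simp: m_def\<close>)
  have "pin_word_of (map (\<lambda>k. ?c (Suc k)) [0..<m]) \<pi>"
  proof (rule pin_word_of_map[where r = ?r])
    fix k assume k: "1 \<le> k" "k \<le> m"
    show "in_quadrant (?c k) (?r ` {..<k}) (?r k) \<or> 2 \<le> k \<and>
        pin_in_dir (?c k) (?r ` {..<k - 1}) (?r (k - 1)) (?r k)"
    proof (cases "k = 1")
      case True
      have "?r ` {..<k} = {?r 0}" unfolding True by (auto simp: lessThan_Suc)
      moreover have "in_quadrant b {?r 0} (?r 1)" using sub unfolding pin_chain_def by blast
      ultimately show ?thesis using True by (simp only: if_True) simp
    next
      case False
      then have "2 \<le> k" using k by simp
      with pin_chainD[OF sub this k(2)] False show ?thesis by (simp only: if_False) simp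
    qed
  next
    have "?r ` {1..m} = p ` K"
    proof -
      have "?r ` {1..m} = p ` (\<lambda>k. i + k - 1) ` {1..m}" unfolding image_image
        by (intro image_cong) auto
      also have "(\<lambda>k. i + k - 1) ` {1..m} = {i..j}"
      proof
        show "{i..j} \<subseteq> (\<lambda>k. i + k - 1) ` {1..m}"
        proof
          fix x assume "x \<in> {i..j}"
          then show "x \<in> (\<lambda>k. i + k - 1) ` {1..m}"
            by (intro image_eqI[of _ _ "x + 1 - i"]) (auto simp: m_def)
        qed
      qed (use i in \<open>auto simp: m_def\<close>)
      finally show ?thesis using Kij by simp
    qed
    then show "order_iso_pts (?r ` {1..m}) (diagram \<pi>)" using iso by simp
  qed
  moreover have "map (\<lambda>k. ?c (Suc k)) [0..<m] = b # ?ds"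
    by (rule nth_equalityI) (use i in \<open>auto simp: m_def nth_Cons split: nat.split\<close>)
  ultimately have pw: "pin_word_of (b # ?ds) \<pi>" by simp
  have altds: "alternating (map (\<lambda>k. w ! k) [s..<j + 1])" for s using alternating_map_nth[OF alt] jw
    by simp
  have up: "[i..<j + 1] = i # [i + 1..<j + 1]" "[i - 1..<j + 1] = (i - 1) # i # [i + 1..<j + 1]"
    using i by (simp_all add: upt_conv_Cons)
  have "w ! (i - 1) # w ! i # ?ds \<in> phi (b # ?ds)"
    by (rule phi_Cons_intro[OF b]) (use altds[of i] up(1) in simp)
  then have "map (\<lambda>k. w ! k) [i - 1..<j + 1] \<in> phi (b # ?ds)" unfolding up(2) by simp
  \<comment> \<open>\<open>i < j\<close> makes \<open>?ds\<close> nonempty, as both notions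
    demand.\<close>
  moreover have "b # ?ds \<in> SP" "strict_pw (b # ?ds)"
    using altds[of "i + 1"] bn i by (auto simp: SP_def strict_pw_def alternating_def)
  ultimately have "map (\<lambda>k. w ! k) [i - 1..<j + 1] \<in> E \<pi>" using pw unfolding E_def by blast
  moreover have "factor (map (\<lambda>k. w ! k) [i - 1..<j + 1]) w"
    by (rule factor_map_nth) (use i jw in auto)
  ultimately show ?thesis by blast
next
  fix h i j assume i: "3 \<le> h" "h + 2 \<le> i" "i \<le> j" and Kij: "K = insert h {i..j}"
  note [simp del] = upt_Suc
  have "j \<in> {3..length w - 1}" using K(1) Kij i by auto
  then have jw: "j < length w" using i by auto
  have dirs: "w ! k \<in> directions" if "k < length w" for k using alt that
    by (auto simp: alternating_def)
  have hv: "horiz (w ! k) = vert (w ! (k + 1))" if "k + 1 < length w" for k using alt that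
    by (auto simp: alternating_def)
  have "horiz (w ! (i - 1)) \<longleftrightarrow> vert (w ! i)" using hv[of "i - 1"] i jw by simp
  then obtain b where b: "quadrant_of b (w ! (i - 1)) (w ! i)"
    using ex_quadrant_of[of "w ! (i - 1)" "w ! i"] dirs[of "i - 1"] dirs[of i] i jw by auto
  have bn: "b \<in> numerals" using b by (auto simp: quadrant_of_cases numerals_def)
  define m where "m = j + 2 - i"
  let ?ds = "map (\<lambda>k. w ! k) [i + 1..<j + 1]"
  have "fst (p (h - 1)) \<noteq> fst (p h) \<and> snd (p (h - 1)) \<noteq> snd (p h)"
    by (rule pin_chain_coords_neq[OF chain]) (use i jw in auto)
  then obtain b0 where b0: "in_quadrant b0 {p (h - 1)} (p h)" using ex_in_quadrant by blast
  \<comment> \<open>The pin before \<open>h\<close> serves as origin. Since \<open>E\<close> passes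
    only the tail of the word to \<open>phi\<close>, \<open>b0\<close> may be whichever numeral
    places \<open>p h\<close> relative to it.\<close>
  let ?r = "\<lambda>k. if k = 0 then p (h - 1) else if k = 1 then p h else p (i + k - 2)"
  let ?c = "\<lambda>k. if k = 1 then b0 else if k = 2 then b else w ! (i + k - 2)"
  have rsub: "?r ` {..<k} \<subseteq> p ` {..<l}" if "k \<le> 2 \<or> i + k \<le> l + 2" "i - 1 \<le> l" for k l
  proof (rule image_subsetI)
    fix t assume "t \<in> {..<k}"
    then show "?r t \<in> p ` {..<l}" using that i by auto
  qed
  have "pin_word_of (map (\<lambda>k. ?c (Suc k)) [0..<m]) \<pi>"
  proof (rule pin_word_of_map[where r = ?r])
    fix k assume k: "1 \<le> k" "k \<le> m"
    consider "k = 1" | "k = 2" | "3 \<le> k" using k by linarith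
    then show "in_quadrant (?c k) (?r ` {..<k}) (?r k) \<or> 2 \<le> k \<and>
        pin_in_dir (?c k) (?r ` {..<k - 1}) (?r (k - 1)) (?r k)"
    proof cases
      case 1
      have "?r ` {..<k} = {p (h - 1)}" unfolding 1 by (auto simp: lessThan_Suc)
      then show ?thesis using b0 1 by simp
    next
      case 2
      have "in_quadrant b (p ` {..<i - 1}) (p i)"
        by (rule pin_chain_in_quadrant[OF chain _ _ b]) (use i jw in auto)
      then have "in_quadrant b (?r ` {..<k}) (p i)"
        by (rule in_quadrant_mono) (rule rsub, use 2 i in auto)
      then show ?thesis using 2 by (simp only:) simp
    next
      case 3
      have "pin_in_dir (w ! (i + k - 2)) (p ` {..<i + k - 2 - 1}) (p (i + k - 2 - 1)) (p (i + k - 2))"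
        by (rule pin_chainD[OF chain]) (use 3 k i jw in \<open>auto simp: m_def\<close>)
      then have "pin_in_dir (w ! (i + k - 2)) (?r ` {..<k - 1}) (p (i + k - 2 - 1)) (p (i + k - 2))"
        by (rule pin_in_dir_mono) (rule rsub, use 3 i in auto)
      moreover have "?r (k - 1) = p (i + k - 2 - 1)" "?r k = p (i + k - 2)" "?c k = w ! (i + k - 2)"
        using 3 by (auto intro!: arg_cong[of _ _ p])
      ultimately show ?thesis using 3 by (simp only:) simp
    qed
  next
    have "?r ` {1..m} = p ` K"
    proof -
      have "{1..m} = insert 1 {2..m}" using i by (auto simp: m_def)
      then have "?r ` {1..m} = insert (p h) (?r ` {2..m})" by (simp only: image_insert) simp
      also have "?r ` {2..m} = p ` (\<lambda>k. i + k - 2) ` {2..m}" unfolding image_image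
        by (intro image_cong) auto
      also have "(\<lambda>k. i + k - 2) ` {2..m} = {i..j}"
      proof
        show "{i..j} \<subseteq> (\<lambda>k. i + k - 2) ` {2..m}"
        proof
          fix x assume "x \<in> {i..j}"
          then show "x \<in> (\<lambda>k. i + k - 2) ` {2..m}"
            by (intro image_eqI[of _ _ "x + 2 - i"]) (auto simp: m_def)
        qed
      qed (use i in \<open>auto simp: m_def\<close>)
      finally show ?thesis using Kij by simp
    qed
    then show "order_iso_pts (?r ` {1..m}) (diagram \<pi>)" using iso by simp
  qed
  moreover have "map (\<lambda>k. ?c (Suc k)) [0..<m] = b0 # b # ?ds"
  proof (rule nth_equalityI)
    show "length (map (\<lambda>k. ?c (Suc k)) [0..<m]) = length (b0 # b # ?ds)" using i
      by (simp add: m_def)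
    fix t assume "t < length (map (\<lambda>k. ?c (Suc k)) [0..<m])"
    then have t: "t < m" by simp
    consider "t = 0" | "t = 1" | k where "t = Suc (Suc k)" by (metis One_nat_def old.nat.exhaust)
    then show "map (\<lambda>k. ?c (Suc k)) [0..<m] ! t = (b0 # b # ?ds) ! t"
      using t by cases (auto simp: m_def)
  qed
  ultimately have pw: "pin_word_of (b0 # b # ?ds) \<pi>" by simp
  have altds: "alternating (map (\<lambda>k. w ! k) [s..<j + 1])" for s using alternating_map_nth[OF alt] jw
    by simp
  have up: "[i..<j + 1] = i # [i + 1..<j + 1]"
    "[i - 3..<j + 1] = (i - 3) # (i - 2) # (i - 1) # i # [i + 1..<j + 1]"
  proof -
    obtain l where "i = l + 3" using i
      by (metis add.commute le_add_diff_inverse le_trans trans_le_add1)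
    then show "[i - 3..<j + 1] = (i - 3) # (i - 2) # (i - 1) # i # [i + 1..<j + 1]"
      using i by (simp add: upt_conv_Cons numeral_eq_Suc)
  qed (use i in \<open>simp add: upt_conv_Cons\<close>)
  \<comment> \<open>Letters \<open>i - 1\<close> and \<open>i\<close> spell \<open>b\<close>, and
    the two before them form the prefix. They exist because \<open>3 \<le> h\<close> and
    \<open>h + 2 \<le> i\<close>; pin \<open>h\<close> itself may lie before the factor.\<close>
  let ?x = "[w ! (i - 3), w ! (i - 2)]" and ?y = "w ! (i - 1) # w ! i # ?ds"
  have y: "?y \<in> phi (tl (b0 # b # ?ds))"
    unfolding list.sel by (rule phi_Cons_intro[OF b]) (use altds[of i] up(1) in simp)
  have v: "map (\<lambda>k. w ! k) [i - 3..<j + 1] = ?x @ ?y" unfolding up(2) by simp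
  have "?x \<in> Xpre"
  proof (rule in_Xpre)
    have "i - 3 + 1 = i - 2" using i by simp
    then show "horiz (w ! (i - 3)) \<longleftrightarrow> vert (w ! (i - 2))" using hv[of "i - 3"] i jw by (simp only:)
  qed (use dirs i jw in auto)
  moreover have "?x @ ?y \<in> M" using altds[of "i - 3"] unfolding v by (simp add: M_def)
  moreover have "quasi_strict_pw (b0 # b # ?ds)"
    using in_quadrant_imp_numeral[OF b0] bn altds[of "i + 1"]
      by (simp add: quasi_strict_pw_def alternating_def)
  \<comment> \<open>A run of one pin leaves a lone numeral, which is outside
    \<open>SP\<close>.\<close>
  moreover have "tl (b0 # b # ?ds) \<in> SP \<or> tl (b0 # b # ?ds) \<in> {[N1],[N2],[N3],[N4]}"
  proof (cases "i = j")
    case True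
    then show ?thesis using bn by (auto simp: numerals_def)
  next
    case False
    then show ?thesis using bn altds[of "i + 1"] i by (simp add: SP_def)
  qed
  ultimately have "?x @ ?y \<in> E \<pi>" using pw y unfolding E_def by blast
  moreover have "factor (map (\<lambda>k. w ! k) [i - 3..<j + 1]) w"
    by (rule factor_map_nth) (use i jw in auto)
  ultimately show ?thesis unfolding v by blast
qed

section \<open>Passing between words and proper pin-permutations\<close>

lemma length_eq_of_pin_rep:
  assumes "pin_rep ps \<sigma>"
  shows "length ps = length \<sigma>"
proof -
  have "pin_seq ps" using assms by (simp add: pin_rep_def)
  then have "distinct ps" unfolding pin_seq_def distinct_conv_nth by metis
  then have "length ps = card (set ps)" by (simp add: distinct_card)
  also have "\<dots> = length \<sigma>"
    using order_iso_pts_card assms unfolding pin_rep_def card_diagram[symmetric] by blast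
  finally show ?thesis .
qed

text \<open>Pins 0, 1 and 2 of the spiral are kept out of \<sigma>. Every occurrence of a pattern
  then starts at pin 3 or later, so the letters and the origin that its pin word requires are
  present.\<close>

lemma proper_pin_perm_of_word:
  assumes "alternating w" "4 \<le> length w" "\<forall>\<pi>\<in>B. simple_perm \<pi> \<and> 2 \<le> length \<pi>"
    and avoid: "\<forall>\<pi>\<in>B. \<forall>v\<in>E \<pi>. \<not> factor v w"
  shows "\<exists>\<sigma>\<in>Av B. proper_pin_perm \<sigma> \<and> length \<sigma> = length w - 3"
proof -
  let ?p = "spiral_pin w" and ?n = "length w - 1"
  obtain a where chain: "pin_chain a (\<lambda>k. w ! k) ?p ?n" using pin_chain_spiral assms(1,2)
    by fastforce
  note inj = pin_chain_inj_on[OF chain]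
  let ?S = "?p ` {3..?n}"
  have sub: "{3..?n} \<subseteq> {..?n}" by auto
  have "inj_on fst ?S" "inj_on snd ?S"
    using inj_on_subset[OF inj(2) image_mono[OF sub]] inj_on_subset[OF inj(3) image_mono[OF sub]]
      by auto
  then obtain \<sigma> where \<sigma>: "is_perm \<sigma>" "length \<sigma> = card ?S" "order_iso_pts ?S (diagram \<sigma>)"
    using ex_standardization[of ?S] by auto
  have len: "length \<sigma> = length w - 3"
    unfolding \<sigma>(2) using card_image[OF inj_on_subset[OF inj(1) sub]] assms(2) by simp
  let ?r = "\<lambda>k. ?p (k + 3)" and ?m = "length w - 3"
  have link: "pin_in_dir (w ! (k + 3)) (?r ` {..<k - 1}) (?r (k - 1)) (?r k)" if k: "1 \<le> k" "k < ?m"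
    for k
  proof -
    have "pin_in_dir (w ! (k + 3)) (?p ` {..<k + 3 - 1}) (?p (k + 3 - 1)) (?p (k + 3))"
      by (rule pin_chainD[OF chain]) (use k in auto)
    moreover have "k + 3 - 1 = k - 1 + 3" using k by simp
    ultimately show ?thesis by (auto intro: pin_in_dir_mono)
  qed
  have seq: "pin_seq (map ?r [0..<?m])" by (rule pin_seq_map) (use link in blast)
  have "proper_pin_seq (map ?r [0..<?m])"
    unfolding proper_pin_seq_def
  proof (intro conjI allI impI seq)
    fix k assume "2 \<le> k \<and> k < length (map ?r [0..<?m])"
    then have k: "1 \<le> k" "k < ?m" by auto
    have "k - 1 < ?m" using k by simp
    then have nth: "map ?r [0..<?m] ! k = ?r k" "map ?r [0..<?m] ! (k - 1) = ?r (k - 1)"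
      "set (take (k - 1) (map ?r [0..<?m])) = ?r ` {..<k - 1}"
      using k(2) by (simp_all only: nth_map_upt set_take_map_upt less_imp_le diff_zero add_0)
    show "separates (map ?r [0..<?m] ! k) {map ?r [0..<?m] ! (k - 1)} (set (take (k - 1) (map ?r [0..<?m])))"
      unfolding nth by (rule pin_in_dir_separates[OF link[OF k]])
  qed
  moreover have "set (map ?r [0..<?m]) = ?S"
  proof -
    have "{3..?n} = (\<lambda>k. k + 3) ` {0..<?m}" using assms(2)
      by (auto simp: image_add_atLeastLessThan' )
    then show ?thesis by (simp only: set_map set_upt image_image)
  qed
  ultimately have "proper_pin_perm \<sigma>"
    unfolding proper_pin_perm_def pin_rep_def using \<sigma> seq by metis
  moreover have "\<sigma> \<in> Av B"
    unfolding Av_def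
  proof (intro CollectI conjI ballI notI \<sigma>(1))
    fix \<pi> assume \<pi>: "\<pi> \<in> B" "contains \<pi> \<sigma>"
    then obtain T where T: "T \<subseteq> ?S" "order_iso_pts T (diagram \<pi>)"
      using contains_iff_pts_iso[OF \<sigma>(3)] by blast
    then obtain K where K: "K \<subseteq> {3..?n}" "T = ?p ` K" by (auto simp: subset_image_iff)
    have "card K = card T" unfolding K(2)
      using card_image[OF inj_on_subset[OF inj(1) order_trans[OF K(1) sub]]] by simp
    also have "\<dots> = length \<pi>" using order_iso_pts_card[OF T(2)] card_diagram by simp
    finally have "2 \<le> card K" using assms(3) \<pi>(1) by simp
    from E_factor_of_simple_pattern[OF assms(1) chain K(1) this _ T(2)[unfolded K(2)]]
    show False using assms(3) avoid \<pi>(1) by blast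
  qed
  ultimately show ?thesis using len by blast
qed

text \<open>The first two pins have no direction, which costs two letters and shifts the indices by
  2.\<close>

lemma word_of_proper_pin_perm:
  assumes "\<sigma> \<in> Av B" "proper_pin_perm \<sigma>" "2 \<le> length \<sigma>"
  shows "\<exists>w. length w = length \<sigma> - 2 \<and> set w \<subseteq> directions \<and> alternating w \<and>
      (\<forall>\<pi>\<in>B. \<forall>v\<in>E \<pi>. \<not> factor v w)"
proof -
  obtain ps where ps: "pin_rep ps \<sigma>" "proper_pin_seq ps" using assms(2)
    by (auto simp: proper_pin_perm_def)
  have len: "length ps = length \<sigma>" using length_eq_of_pin_rep[OF ps(1)] .
  let ?n = "length ps - 1"
  obtain a d where chain: "pin_chain a d (\<lambda>k. ps ! k) ?n"
    using pin_chain_of_proper_pin_seq[OF ps(2)] len assms(3) by auto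
  have "{..?n} = {0..<length ps}" using len assms(3) by auto
  then have "(\<lambda>k. ps ! k) ` {..?n} = set ps" using nth_image[of "length ps" ps] by simp
  then have iso: "order_iso_pts ((\<lambda>k. ps ! k) ` {..?n}) (diagram \<sigma>)" using ps(1)
    by (simp add: pin_rep_def)
  define w where "w = map (\<lambda>t. d (t + 2)) [0..<length \<sigma> - 2]"
  have wlen: "length w = length \<sigma> - 2" and wnth: "\<And>t. t < length w \<Longrightarrow> w ! t = d (t + 2)"
    by (auto simp: w_def)
  have dirs: "set w \<subseteq> directions"
  proof
    fix x assume "x \<in> set w"
    then obtain t where "t < length \<sigma> - 2" "x = d (t + 2)" by (auto simp: w_def)
    then show "x \<in> directions"
      using pin_in_dir_imp_direction[OF pin_chainD[OF chain, of "t + 2"]] len by simp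
  qed
  moreover have "alternating w"
    unfolding alternating_def
  proof (intro conjI allI impI dirs)
    fix t assume t: "t + 1 < length w"
    have "horiz (d (t + 2)) = vert (d (Suc (t + 2)))"
      by (rule pin_chain_alternates[OF chain]) (use t wlen len in auto)
    then show "horiz (w ! t) = vert (w ! (t + 1))" using wnth[of t] wnth[of "t + 1"] t by simp
  qed
  moreover have "\<not> factor v w" if "\<pi> \<in> B" "v \<in> E \<pi>" for \<pi> v
  proof
    assume "factor v w"
    then obtain s where s: "s + length v \<le> length w" "\<And>t. t < length v \<Longrightarrow> v ! t = w ! (s + t)"
      unfolding factor_iff_nth by blast
    have "contains \<pi> \<sigma>"
    proof (rule contains_of_E_factor[OF chain iso that(2)])
      \<comment> \<open>The last letter of \<open>v\<close> is the direction of pin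
        \<open>s + length v + 1\<close>.\<close>
      show "s + length v + 1 \<le> ?n" using s(1) wlen len assms(3) by linarith
      show "v ! t = d (s + 2 + t)" if "t < length v" for t
        using s(2)[OF that] wnth[of "s + t"] s(1) that by (simp add: ac_simps)
    qed
    then show False using assms(1) that(1) by (auto simp: Av_def)
  qed
  ultimately show ?thesis using wlen by blast
qed

theorem theorem3:
  fixes B :: "nat list set"
  assumes "\<forall>\<pi>\<in>B. simple_perm \<pi>"
    and "\<forall>\<pi>\<in>B. 2 \<le> length \<pi>"
  shows "(\<forall>N. \<exists>\<sigma>\<in>Av B. proper_pin_perm \<sigma> \<and> N \<le> length \<sigma>) \<longleftrightarrow>
         (\<forall>N. \<exists>w. N \<le> length w \<and> set w \<subseteq> directions \<and>
              (\<forall>v \<in> (\<Union>\<pi>\<in>B. E \<pi>) \<union> {[L,L],[L,R],[R,R],[R,L],[U,U],[U,D],[D,D],[D,U]}.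
                  \<not> factor v w))"
proof (intro iffI allI)
  fix N assume "\<forall>N. \<exists>\<sigma>\<in>Av B. proper_pin_perm \<sigma> \<and> N \<le> length \<sigma>"
  then obtain \<sigma> where \<sigma>: "\<sigma> \<in> Av B" "proper_pin_perm \<sigma>" "N + 3 \<le> length \<sigma>" by blast
  then obtain w where w: "length w = length \<sigma> - 2" "set w \<subseteq> directions" "alternating w"
    "\<forall>\<pi>\<in>B. \<forall>v\<in>E \<pi>. \<not> factor v w"
    using word_of_proper_pin_perm[OF \<sigma>(1,2)] by auto
  have "\<forall>v \<in> (\<Union>\<pi>\<in>B. E \<pi>) \<union> {[L,L],[L,R],[R,R],[R,L],[U,U],[U,D],[D,D],[D,U]}. \<not> factor v w"
    using w(3,4) unfolding alternating_iff_no_factor[OF w(2)] by blast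
  then show "\<exists>w. N \<le> length w \<and> set w \<subseteq> directions \<and>
      (\<forall>v \<in> (\<Union>\<pi>\<in>B. E \<pi>) \<union> {[L,L],[L,R],[R,R],[R,L],[U,U],[U,D],[D,D],[D,U]}. \<not> factor v w)"
    using w(1,2) \<sigma>(3) by (intro exI[of _ w]) simp
next
  fix N assume "\<forall>N. \<exists>w. N \<le> length w \<and> set w \<subseteq> directions \<and>
      (\<forall>v \<in> (\<Union>\<pi>\<in>B. E \<pi>) \<union> {[L,L],[L,R],[R,R],[R,L],[U,U],[U,D],[D,D],[D,U]}. \<not> factor v w)"
  \<comment> \<open>Three letters are lost to the omitted pins; a fourth keeps the pin sequence
    nonempty.\<close>
  then obtain w where w: "N + 4 \<le> length w" "set w \<subseteq> directions"
    "\<forall>v \<in> (\<Union>\<pi>\<in>B. E \<pi>) \<union> {[L,L],[L,R],[R,R],[R,L],[U,U],[U,D],[D,D],[D,U]}. \<not> factor v w" by blast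
  have "alternating w" "\<forall>\<pi>\<in>B. \<forall>v\<in>E \<pi>. \<not> factor v w"
    using w(3) unfolding alternating_iff_no_factor[OF w(2)] by blast+
  from proper_pin_perm_of_word[OF this(1) _ _ this(2)] assms w(1)
  obtain \<sigma> where "\<sigma> \<in> Av B" "proper_pin_perm \<sigma>" "length \<sigma> = length w - 3" by auto
  then show "\<exists>\<sigma>\<in>Av B. proper_pin_perm \<sigma> \<and> N \<le> length \<sigma>" using w(1) by auto
qed

end
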